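(* Let $a,b>0$ and $g\in L^2(\mathbb{R})$. If $(g,a,b)$ satisfies the CC-condition, then the WH-frame Identity $$\sum_{m,n\in\mathbb{Z}}|\langle f,E_{mb}T_{na}g\rangle|^2=\frac1b\sum_{k\in\mathbb{Z}}\int_{\mathbb{R}}\overline{f(t)}f(t-k/b)G_k(t)\,dt$$ holds for all $f\in L^2(\mathbb{R})$ and the series on the right-hand side converges unconditionally. In particular, if $g\in W(L^\infty,L^1)$, then the WH-frame Identity holds for all $f\in L^2(\mathbb{R})$ and the series on the right-hand side converges unconditionally.
   Context: For $c\in\mathbb{R}$ let $T_cf(x)=f(x-c)$ and $E_cf(x)=e^{2\pi i c x}f(x)$. For $k\in\mathbb{Z}$ put $G_k(t)=\sum_{n\in\mathbb{Z}}g(t-na)\overline{g(t-na-k/b)}$. $(g,a,b)$ satisfies the CC-condition if there is a constant $B$ with $\sum_{k\in\mathbb{Z}}|G_k(t)|\le B$ for almost every $t\in\mathbb{R}$. The Wiener amalgam space $W(L^\infty,L^1)$ consists of all measurable functions $g$ on $\mathbb{R}$ such that for some $\alpha>0$ one has $\sum_{n\in\mathbb{Z}}\|g\cdot\chi_{[\alpha n,\alpha(n+1))}\|_\infty<\infty$ (finiteness for one $\alpha>0$ implies finiteness for all $\alpha>0$). That the identity holds for $f$ includes that the left-hand side is finite. *)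

theory Defs
  imports "HOL-Analysis.Analysis" "HOL-Probability.Essential_Supremum"
begin

text \<open>
  Elements of \<open>L\<^sup>2(\<real>)\<close> and of the amalgam space are represented by functions that are
  measurable with respect to Lebesgue measure (the completion of \<open>lborel\<close>). Nothing below
  depends on the choice of a representative modulo null sets.
\<close>

definition L2 :: "(real \<Rightarrow> complex) set" where
  "L2 = {f \<in> borel_measurable lebesgue. integrable lebesgue (\<lambda>x. (norm (f x))\<^sup>2)}"

definition L2_inner :: "(real \<Rightarrow> complex) \<Rightarrow> (real \<Rightarrow> complex) \<Rightarrow> complex" where
  "L2_inner f h = (LINT x|lebesgue. f x * cnj (h x))"

definition translation :: "real \<Rightarrow> (real \<Rightarrow> complex) \<Rightarrow> real \<Rightarrow> complex" where
  "translation c f = (\<lambda>x. f (x - c))"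

definition modulation :: "real \<Rightarrow> (real \<Rightarrow> complex) \<Rightarrow> real \<Rightarrow> complex" where
  "modulation c f = (\<lambda>x. exp (2 * of_real pi * \<i> * of_real c * of_real x) * f x)"

text \<open>
  For \<open>g \<in> L\<^sup>2(\<real>)\<close> the periodization \<open>\<Sum>n. |g(t - na)|\<^sup>2\<close> is finite for almost every \<open>t\<close>, so
  by Cauchy-Schwarz the series below converges absolutely for almost every \<open>t\<close>, simultaneously
  for all \<open>k\<close>. The junk value 0 of \<open>infsum\<close> is therefore only taken on a null set.
\<close>

definition G :: "(real \<Rightarrow> complex) \<Rightarrow> real \<Rightarrow> real \<Rightarrow> int \<Rightarrow> real \<Rightarrow> complex" where
  "G g a b k t =
     (\<Sum>\<^sub>\<infinity>n::int. g (t - of_int n * a) * cnj (g (t - of_int n * a - of_int k / b)))"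

definition CC_condition :: "(real \<Rightarrow> complex) \<Rightarrow> real \<Rightarrow> real \<Rightarrow> bool" where
  "CC_condition g a b \<longleftrightarrow>
     (\<exists>B::real. AE t in lebesgue.
        (\<lambda>k. norm (G g a b k t)) summable_on UNIV \<and> (\<Sum>\<^sub>\<infinity>k. norm (G g a b k t)) \<le> B)"

text \<open>
  The essential supremum and the sum over \<open>n\<close> are taken in \<open>ennreal\<close>, where both always exist,
  so that \<open>< \<infinity>\<close> expresses genuine finiteness.
\<close>

definition wiener_amalgam :: "(real \<Rightarrow> complex) set" where
  "wiener_amalgam = {g \<in> borel_measurable lebesgue. \<exists>\<alpha>>0.
     (\<Sum>\<^sub>\<infinity>n::int. esssup lebesgue
        (\<lambda>x. ennreal (norm (g x * indicator {\<alpha> * of_int n ..< \<alpha> * (of_int n + 1)} x)))) < \<infinity>}"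

definition WH_rhs_term ::
    "(real \<Rightarrow> complex) \<Rightarrow> real \<Rightarrow> real \<Rightarrow> (real \<Rightarrow> complex) \<Rightarrow> int \<Rightarrow> complex" where
  "WH_rhs_term g a b f k = (LINT t|lebesgue. cnj (f t) * f (t - of_int k / b) * G g a b k t)"

text \<open>
  The identity includes that the left-hand side is finite (for nonnegative terms this is
  \<open>summable_on\<close>) and that every integral on the right-hand side exists. Convergence of the series
  over \<open>k\<close> is not part of this predicate: \<open>infsum\<close> is its sum only together with
  \<open>WH_rhs_term g a b f summable_on UNIV\<close>, which is unconditional convergence of that series.
\<close>

definition WH_frame_identity ::
    "(real \<Rightarrow> complex) \<Rightarrow> real \<Rightarrow> real \<Rightarrow> (real \<Rightarrow> complex) \<Rightarrow> bool" where
  "WH_frame_identity g a b f \<longleftrightarrow>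
     (\<lambda>(m::int, n::int). (norm (L2_inner f
        (modulation (of_int m * b) (translation (of_int n * a) g))))\<^sup>2) summable_on UNIV \<and>
     (\<forall>k::int. integrable lebesgue (\<lambda>t. cnj (f t) * f (t - of_int k / b) * G g a b k t)) \<and>
     of_real (\<Sum>\<^sub>\<infinity>(m::int, n::int). (norm (L2_inner f
        (modulation (of_int m * b) (translation (of_int n * a) g))))\<^sup>2) =
       1 / of_real b * (\<Sum>\<^sub>\<infinity>k. WH_rhs_term g a b f k)"

end

theory Submission
  imports Defs
begin

text \<open>
  For fixed \<open>n\<close> put \<open>h\<^sub>n(t) = f(t) cnj(g(t - n a))\<close>. The coefficient of \<open>f\<close> with index \<open>(m, n)\<close> is the
  Fourier transform of \<open>h\<^sub>n\<close> at \<open>m b\<close>, that is, the \<open>m\<close>-th Fourier coefficient of the periodization of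
  \<open>h\<^sub>n\<close> with period \<open>1/b\<close>. Parseval's identity turns the sum over \<open>m\<close> into the square integral of this
  periodization over one period, and unfolding gives the sum over \<open>k\<close> of the autocorrelations of \<open>h\<^sub>n\<close> at
  \<open>k/b\<close>, multiplied by \<open>1/b\<close> (lemma \<open>sampled_fourier_autocorrelation\<close>). Summing over \<open>n\<close> under the
  integral sign collects the products of translates of \<open>g\<close> into \<open>G\<^sub>k\<close>.

  If \<open>f\<close> is bounded with bounded support, all of this is legitimate: only finitely many \<open>k\<close> occur, and
  the term \<open>k = 0\<close> of the CC-condition bounds the sum of \<open>\<bar>g(t - n a)\<bar>\<^sup>2\<close> over \<open>n\<close>, hence also \<open>g\<close> itself
  (lemma \<open>identity_bounded_support\<close>).

  For arbitrary \<open>f\<close> the decisive estimate is that the integrals on the right-hand side, with absolute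
  values inside, sum to at most \<open>B\<close> times the square norm of \<open>f\<close>. This follows from the
  arithmetic-geometric mean inequality and the symmetry \<open>G\<^sub>k(t + k/b) = cnj(G\<^sub>-\<^sub>k(t))\<close> (lemma
  \<open>rhs_nn_bound\<close>). It gives unconditional convergence, and through the identity for truncations of \<open>f\<close> it
  gives a Bessel inequality for the coefficients (lemma \<open>bessel\<close>). Now let \<open>f\<^sub>N\<close> be truncations of \<open>f\<close>: the
  left-hand side converges by the Bessel inequality applied to \<open>f - f\<^sub>N\<close>, the right-hand side by dominated
  convergence, and the identity passes to the limit.

  Parseval's identity itself rests on the density of trigonometric polynomials: a bounded measurable
  function is almost everywhere a limit of uniformly bounded continuous functions that close up to
  functions on the circle, where the Stone-Weierstrass theorem applies.

  Finally, the periodizations of a function in the Wiener amalgam space are essentially bounded, which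
  bounds the double sum of \<open>\<bar>g(t - n a)\<bar> \<bar>g(t - n a - k/b)\<bar>\<close> and yields the CC-condition (lemma
  \<open>wiener_amalgam_imp_CC\<close>).
\<close>

section \<open>Trigonometric polynomials\<close>

definition wave :: "real \<Rightarrow> real \<Rightarrow> complex" where
  "wave c x = exp (2 * of_real pi * \<i> * of_real c * of_real x)"

lemma wave_cis: "wave c x = cis (2 * pi * c * x)"
  by (simp add: wave_def cis_conv_exp mult_ac)

lemma norm_wave [simp]: "norm (wave c x) = 1"
  by (simp add: wave_cis)

lemma wave_0 [simp]: "wave 0 x = 1"
  by (simp add: wave_def)

lemma cnj_wave [simp]: "cnj (wave c x) = wave (- c) x"
  by (simp add: wave_cis cis_cnj)

lemma wave_add: "wave (c + d) x = wave c x * wave d x"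
  by (simp add: wave_cis cis_mult algebra_simps)

lemma wave_diff_right: "wave c (x - y) = wave c x * wave (- c) y"
  by (simp add: wave_cis cis_mult algebra_simps)

lemma wave_int_eq_1: "wave c x = 1" if "c * x \<in> \<int>"
proof -
  from that obtain k where "c * x = of_int k" by (rule Ints_cases)
  then have "2 * pi * c * x = 2 * pi * of_int k" by simp
  then show ?thesis unfolding wave_cis by (simp only: cis_multiple_2pi Ints_of_int)
qed

lemma continuous_on_wave [continuous_intros]: "continuous_on S (wave c)"
  unfolding wave_def by (intro continuous_intros)

lemma wave_measurable [measurable]: "wave c \<in> borel_measurable lebesgue"
proof -
  have "wave c \<in> borel_measurable lborel"
    using borel_measurable_continuous_onI[OF continuous_on_wave, of c] by simp
  then show ?thesis by (rule measurable_completion)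
qed

definition trig_poly :: "real \<Rightarrow> (real \<Rightarrow> complex) \<Rightarrow> bool" where
  "trig_poly b T \<longleftrightarrow>
     (\<exists>I a. finite (I :: int set) \<and> T = (\<lambda>t. \<Sum>m\<in>I. a m * wave (of_int m * b) t))"

lemma trig_polyE:
  assumes "trig_poly b T"
  obtains I a where "finite (I :: int set)" "T = (\<lambda>t. \<Sum>m\<in>I. a m * wave (of_int m * b) t)"
  using assms unfolding trig_poly_def by blast

lemma trig_poly_wave: "trig_poly b (\<lambda>t. c * wave (of_int m * b) t)"
  unfolding trig_poly_def by (intro exI[of _ "{m}"] exI[of _ "\<lambda>_. c"]) auto

lemma trig_poly_add:
  assumes "trig_poly b S" "trig_poly b T"
  shows "trig_poly b (\<lambda>t. S t + T t)"
proof -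
  from assms(1) obtain I a where I: "finite (I :: int set)"
    and S: "S = (\<lambda>t. \<Sum>m\<in>I. a m * wave (of_int m * b) t)" by (rule trig_polyE)
  from assms(2) obtain J c where J: "finite (J :: int set)"
    and T: "T = (\<lambda>t. \<Sum>m\<in>J. c m * wave (of_int m * b) t)" by (rule trig_polyE)
  have S': "S t = (\<Sum>m\<in>I \<union> J. (if m \<in> I then a m else 0) * wave (of_int m * b) t)" for t
    unfolding S using I J by (intro sum.mono_neutral_cong_left) auto
  have T': "T t = (\<Sum>m\<in>I \<union> J. (if m \<in> J then c m else 0) * wave (of_int m * b) t)" for t
    unfolding T using I J by (intro sum.mono_neutral_cong_left) auto
  have "(\<lambda>t. S t + T t) = (\<lambda>t. \<Sum>m\<in>I \<union> J.
      ((if m \<in> I then a m else 0) + (if m \<in> J then c m else 0)) * wave (of_int m * b) t)"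
    unfolding S' T' sum.distrib[symmetric] distrib_right ..
  moreover have "finite (I \<union> J)" using I J by simp
  ultimately show ?thesis unfolding trig_poly_def
    by (intro exI[of _ "I \<union> J"] exI[of _ "\<lambda>m. (if m \<in> I then a m else 0) + (if m \<in> J then c m else 0)"] conjI)
qed

lemma trig_poly_0: "trig_poly b (\<lambda>t. 0)"
  unfolding trig_poly_def by (intro exI[of _ "{}"]) auto

lemma trig_poly_sum:
  "finite X \<Longrightarrow> (\<And>x. x \<in> X \<Longrightarrow> trig_poly b (T x)) \<Longrightarrow> trig_poly b (\<lambda>t. \<Sum>x\<in>X. T x t)"
  by (induction X rule: finite_induct) (auto intro: trig_poly_0 trig_poly_add)

lemma trig_poly_mult:
  assumes "trig_poly b S" "trig_poly b T"
  shows "trig_poly b (\<lambda>t. S t * T t)"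
proof -
  from assms(1) obtain I a where I: "finite (I :: int set)"
    and S: "S = (\<lambda>t. \<Sum>m\<in>I. a m * wave (of_int m * b) t)" by (rule trig_polyE)
  from assms(2) obtain J c where J: "finite (J :: int set)"
    and T: "T = (\<lambda>t. \<Sum>m\<in>J. c m * wave (of_int m * b) t)" by (rule trig_polyE)
  have eq: "(\<lambda>t. S t * T t) = (\<lambda>t. \<Sum>x\<in>I. \<Sum>y\<in>J. a x * c y * wave (of_int (x + y) * b) t)"
    unfolding S T sum_product by (intro ext sum.cong refl) (simp add: wave_add distrib_right)
  show ?thesis unfolding eq
    by (rule trig_poly_sum[OF I], rule trig_poly_sum[OF J], rule trig_poly_wave)
qed

lemma trig_poly_const: "trig_poly b (\<lambda>t. c)"
  using trig_poly_wave[of b c 0] by simp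

text \<open>
  A linear functional of a point of the unit circle is a combination of cosine and sine, hence of the
  waves of frequency \<open>b\<close> and \<open>- b\<close>; trigonometric polynomials form an algebra, so this extends to
  all polynomials.
\<close>

lemma trig_poly_real_polynomial:
  assumes "real_polynomial_function P"
  shows "trig_poly b (\<lambda>t. of_real (P (wave b t)))"
  using assms
proof (induction rule: real_polynomial_function.induct)
  case (linear f)
  have "of_real (f (wave b t)) = (of_real (f 1) / 2 + of_real (f \<i>) / (2 * \<i>)) * wave (of_int 1 * b) t
        + (of_real (f 1) / 2 - of_real (f \<i>) / (2 * \<i>)) * wave (of_int (- 1) * b) t" for t
  proof -
    interpret bounded_linear f by fact
    have "f (wave b t) = f (Re (wave b t) *\<^sub>R 1 + Im (wave b t) *\<^sub>R \<i>)"
      by (rule arg_cong[of _ _ f]) (simp add: complex_eq_iff)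
    also have "\<dots> = Re (wave b t) * f 1 + Im (wave b t) * f \<i>"
      by (simp add: add scaleR)
    finally show ?thesis
      by (simp add: complex_eq_iff wave_cis field_simps)
  qed
  then show ?case by (simp only:) (intro trig_poly_add trig_poly_wave)
next
  case (const c)
  show ?case by (rule trig_poly_const)
qed (simp_all add: trig_poly_add trig_poly_mult)

lemma trig_poly_polynomial:
  assumes "polynomial_function P"
  shows "trig_poly b (\<lambda>t. P (wave b t))"
proof -
  have *: "P z = of_real (Re (P z)) + \<i> * of_real (Im (P z))" for z
    by (rule complex_eq)
  have "real_polynomial_function (Re \<circ> P)" "real_polynomial_function (Im \<circ> P)"
    using assms bounded_linear_Re bounded_linear_Im unfolding polynomial_function_def by blast+
  from this[THEN trig_poly_real_polynomial, of b] show ?thesis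
    by (subst *) (auto intro!: trig_poly_add trig_poly_mult trig_poly_const simp: o_def)
qed

text \<open>
  A continuous loop on \<open>[0, 1/b]\<close> factors through the circle because \<open>t \<mapsto> wave b t\<close> maps this compact
  interval onto the circle and is therefore a quotient map: the preimage of a closed set under the
  factor is the image of a compact set.
\<close>

lemma continuous_on_circle_lift:
  fixes Q :: "real \<Rightarrow> complex"
  assumes "b > 0" and Q: "continuous_on {0..1/b} Q" and Q0: "Q 0 = Q (1/b)"
  obtains q where "continuous_on (sphere 0 1) q" "\<And>t. t \<in> {0..1/b} \<Longrightarrow> q (wave b t) = Q t"
proof -
  define q where "q z = Q (Arg2pi z / (2 * pi * b))" for z
  have qQ: "q (wave b t) = Q t" if t: "t \<in> {0..1/b}" for t
  proof (cases "t = 1/b")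
    case True
    then have "wave b t = 1" using assms by (intro wave_int_eq_1) simp
    then show ?thesis using Q0 True assms by (simp add: q_def Arg2pi_real)
  next
    case False
    then have "2 * pi * b * t < 2 * pi" using t assms by (auto simp: field_simps)
    moreover have "0 \<le> 2 * pi * b * t" using t assms by auto
    ultimately have "Arg2pi (wave b t) = 2 * pi * b * t"
      by (intro Arg2pi_unique[of 1]) (auto simp: wave_def mult_ac)
    then show ?thesis using assms by (simp add: q_def)
  qed
  have surj: "\<exists>t\<in>{0..1/b}. z = wave b t" if "z \<in> sphere 0 1" for z
  proof
    let ?t = "Arg2pi z / (2 * pi * b)"
    show "?t \<in> {0..1/b}" using Arg2pi[of z] assms by (auto simp: field_simps)
    show "z = wave b ?t" using that assms complex_norm_eq_1_exp[of z] by (auto simp: wave_def mult_ac)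
  qed
  have "continuous_on (sphere 0 1) q"
  proof (subst continuous_on_closed_vimage)
    show "closed (sphere 0 (1::real) :: complex set)" by simp
    show "\<forall>B. closed B \<longrightarrow> closed (q -` B \<inter> sphere 0 1)"
    proof (intro allI impI)
      fix B :: "complex set" assume B: "closed B"
      have "q -` B \<inter> sphere 0 1 = wave b ` (Q -` B \<inter> {0..1/b})"
        using qQ surj by (force simp: image_iff)
      moreover have "closed (Q -` B \<inter> {0..1/b})"
        using Q B by (intro continuous_closed_preimage[of "{0..1/b}" Q B, unfolded Int_commute[of "{0..1/b}"]]) auto
      then have "compact (Q -` B \<inter> {0..1/b})"
        by (metis closed_Int_compact compact_Icc inf.idem inf_assoc)
      ultimately show "closed (q -` B \<inter> sphere 0 1)"
        by (simp add: compact_imp_closed compact_continuous_image continuous_on_wave)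
    qed
  qed
  with qQ that show ?thesis by blast
qed

text \<open>
  This is the Stone-Weierstrass theorem on the circle, pulled back to the line.
\<close>

lemma trig_poly_uniform_approx:
  assumes "b > 0" and "continuous_on {0..1/b} Q" and "Q 0 = Q (1/b)" and "e > 0"
  shows "\<exists>T. trig_poly b T \<and> (\<forall>t\<in>{0..1/b}. norm (Q t - T t) < e)"
proof -
  obtain q where q: "continuous_on (sphere 0 1) q" "\<And>t. t \<in> {0..1/b} \<Longrightarrow> q (wave b t) = Q t"
    using continuous_on_circle_lift assms by metis
  obtain P where P: "polynomial_function P" "\<forall>z\<in>sphere 0 1. norm (q z - P z) < e"
    using Stone_Weierstrass_polynomial_function[OF _ q(1) \<open>e > 0\<close>] by auto
  have "norm (Q t - P (wave b t)) < e" if "t \<in> {0..1/b}" for t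
    using P(2) q(2)[OF that] by (metis mem_sphere_0 norm_wave)
  with trig_poly_polynomial[OF P(1)] show ?thesis by blast
qed

text \<open>
  A measurable function is almost everywhere a limit of continuous ones. Projecting these onto the
  disc of radius \<open>C\<close> keeps the approximation uniformly bounded, as dominated convergence requires, and
  a cutoff near the endpoints of the period makes them close up to loops that can be approximated
  uniformly.
\<close>

lemma trig_poly_AE_approx:
  fixes F :: "real \<Rightarrow> complex"
  assumes "b > 0" and F: "F \<in> borel_measurable lebesgue" and C: "AE t in lebesgue. norm (F t) \<le> C" "0 \<le> C"
  obtains T where "\<And>n. trig_poly b (T n)"
    and "\<And>n t. t \<in> {0..1/b} \<Longrightarrow> norm (T n t) \<le> C + 1"
    and "AE t in lebesgue. t \<in> {0<..<1/b} \<longrightarrow> (\<lambda>n. T n t) \<longlonglongrightarrow> F t"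
proof -
  have "F measurable_on UNIV" by (rule lebesgue_measurable_imp_measurable_on[OF F]) simp
  then obtain N \<Phi> where N: "negligible N" and \<Phi>: "\<And>n. continuous_on UNIV (\<Phi> n)"
    and lim: "\<And>x. x \<notin> N \<Longrightarrow> (\<lambda>n. \<Phi> n x) \<longlonglongrightarrow> F x"
    unfolding measurable_on_def by auto
  define clip :: "complex \<Rightarrow> complex" where "clip = closest_point (cball 0 C)"
  have clip: "continuous_on UNIV clip" "\<And>z. norm (clip z) \<le> C" "\<And>z. norm z \<le> C \<Longrightarrow> clip z = z"
    using closest_point_in_set[of "cball (0::complex) C"] C(2)
    by (auto simp: clip_def intro!: continuous_on_closest_point closest_point_self)
  \<comment> \<open>The cutoffs vanish at both endpoints of the period and tend to 1 inside it.\<close>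
  define \<psi> :: "nat \<Rightarrow> real \<Rightarrow> real" where "\<psi> n t = max 0 (min 1 (of_nat n * (t * (1/b - t))))" for n t
  have \<psi>: "continuous_on S (\<psi> n)" "0 \<le> \<psi> n t" "\<psi> n t \<le> 1" "\<psi> n 0 = 0" "\<psi> n (1/b) = 0" for S n t
    unfolding \<psi>_def by (intro continuous_intros | simp)+
  have \<psi>_lim: "(\<lambda>n. \<psi> n t) \<longlonglongrightarrow> 1" if t: "t \<in> {0<..<1/b}" for t
  proof (rule tendsto_eventually)
    have pos: "0 < t * (1/b - t)" using t by simp
    obtain n0 where n0: "1 < of_nat n0 * (t * (1/b - t))"
      using reals_Archimedean3[OF pos] by blast
    show "\<forall>\<^sub>F n in sequentially. \<psi> n t = 1"
      using eventually_ge_at_top[of n0]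
    proof eventually_elim
      case (elim n)
      then have "of_nat n0 * (t * (1/b - t)) \<le> of_nat n * (t * (1/b - t))"
        using pos by (intro mult_right_mono) auto
      with n0 show ?case by (simp add: \<psi>_def)
    qed
  qed
  define Q where "Q n t = of_real (\<psi> n t) * clip (\<Phi> n t)" for n t
  have "\<exists>T. trig_poly b T \<and> (\<forall>t\<in>{0..1/b}. norm (Q n t - T t) < 1 / Suc n)" for n
  proof (rule trig_poly_uniform_approx[OF \<open>b > 0\<close>])
    show "continuous_on {0..1/b} (Q n)" unfolding Q_def
      by (intro continuous_intros \<psi> continuous_on_compose2[OF clip(1)] continuous_on_subset[OF \<Phi>]) auto
  qed (use \<psi> in \<open>auto simp: Q_def\<close>)
  then obtain T where T: "\<And>n. trig_poly b (T n)" 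
    "\<And>n t. t \<in> {0..1/b} \<Longrightarrow> norm (Q n t - T n t) < 1 / Suc n" by metis
  have normQ: "norm (Q n t) \<le> C" for n t
    using mult_mono[of "\<psi> n t" 1 "norm (clip (\<Phi> n t))" C] \<psi>(2,3)[of n t] clip(2)
    by (simp add: Q_def norm_mult)
  have "norm (T n t) \<le> C + 1" if "t \<in> {0..1/b}" for n t
  proof -
    have "norm (T n t) \<le> norm (Q n t) + norm (Q n t - T n t)" 
      by (metis norm_triangle_sub norm_minus_commute)
    also have "\<dots> \<le> C + 1 / Suc n" using normQ T(2)[OF that, of n] by (intro add_mono) auto
    also have "\<dots> \<le> C + 1" by simp
    finally show ?thesis .
  qed
  moreover have "AE t in lebesgue. t \<in> {0<..<1/b} \<longrightarrow> (\<lambda>n. T n t) \<longlonglongrightarrow> F t"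
  proof -
    have "AE t in lebesgue. t \<notin> N" using N 
      by (simp add: AE_not_in negligible_iff_null_sets)
    with C(1) show ?thesis
    proof eventually_elim
      case (elim t)
      show ?case
      proof
        assume t: "t \<in> {0<..<1/b}"
        have "(\<lambda>n. clip (\<Phi> n t)) \<longlonglongrightarrow> clip (F t)"
          by (rule continuous_on_tendsto_compose[OF clip(1) lim[OF elim(2)]]) auto
        then have "(\<lambda>n. Q n t) \<longlonglongrightarrow> of_real 1 * clip (F t)"
          unfolding Q_def by (intro tendsto_intros \<psi>_lim t)
        moreover have "(\<lambda>n. Q n t - T n t) \<longlonglongrightarrow> 0"
        proof (rule Lim_null_comparison[OF _ LIMSEQ_inverse_real_of_nat])
          show "\<forall>\<^sub>F n in sequentially. norm (Q n t - T n t) \<le> inverse (real (Suc n))"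
            using T(2)[of t] t by (auto simp: field_simps intro!: always_eventually less_imp_le)
        qed
        ultimately have "(\<lambda>n. Q n t - (Q n t - T n t)) \<longlonglongrightarrow> of_real 1 * clip (F t) - 0"
          by (rule tendsto_diff)
        then show "(\<lambda>n. T n t) \<longlonglongrightarrow> F t" using clip(3) elim(1) by simp
      qed
    qed
  qed
  ultimately show ?thesis using T(1) that by blast
qed

section \<open>Parseval's identity on a period\<close>

lemma trig_poly_measurable:
  assumes "trig_poly b T"
  shows "T \<in> borel_measurable lebesgue"
proof -
  from assms obtain I a where "T = (\<lambda>t. \<Sum>m\<in>I. a m * wave (of_int m * b) t)"
    by (rule trig_polyE)
  then show ?thesis by simp
qed

lemma borel_measurable_cnj [measurable (raw)]:
  "f \<in> borel_measurable M \<Longrightarrow> (\<lambda>x. cnj (f x)) \<in> borel_measurable M"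
  by (rule measurable_compose[OF _ borel_measurable_continuous_onI[of cnj]]) (auto intro: continuous_intros)

abbreviation period_cell :: "real \<Rightarrow> real measure" where
  "period_cell b \<equiv> lebesgue_on {0..<1/b}"

lemma finite_measure_period_cell: "finite_measure (period_cell b)"
  by (intro finite_measureI, cases "0 \<le> 1/b") (auto simp: emeasure_restrict_space)

lemma integrable_period_cell:
  fixes h :: "real \<Rightarrow> 'a::{banach,second_countable_topology}"
  assumes "h \<in> borel_measurable lebesgue" "AE x in period_cell b. norm (h x) \<le> C"
  shows "integrable (period_cell b) h"
  using assms
  by (intro finite_measure.integrable_const_bound[OF finite_measure_period_cell]) (auto intro: measurable_restrict_space1)

lemma AE_period_cell: "AE x in lebesgue. P x \<Longrightarrow> AE x in period_cell b. P x"
  by (auto simp: AE_restrict_space_iff elim: eventually_mono)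

lemma integral_wave:
  fixes m :: int
  assumes b: "b > 0"
  shows "(LINT x|period_cell b. wave (of_int m * b) x) = (if m = 0 then 1 / of_real b else 0)"
proof (cases "m = 0")
  case True
  have "measure lebesgue {0..<1/b} = 1/b" using b by simp
  then show ?thesis using True b by (simp add: measure_restrict_space scaleR_conv_of_real)
next
  case False
  define k where "k = 2 * of_real pi * \<i> * of_real (of_int m * b)"
  have k: "k \<noteq> 0" using False b by (simp add: k_def)
  have w: "wave (of_int m * b) x = exp (k * of_real x)" for x
    by (simp add: wave_def k_def)
  have "((\<lambda>x. exp (k * of_real x)) has_integral (exp (k * of_real (1/b)) / k - exp (k * of_real 0) / k)) {0..1/b}"
  proof (rule fundamental_theorem_of_calculus)
    show "0 \<le> 1 / b" using b by simp
    fix x :: real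
    have "((\<lambda>x. exp (k * of_real x) / k) has_vector_derivative (exp (k * of_real x) * k) / k) (at x within {0..1/b})"
      by (auto intro!: derivative_eq_intros has_vector_derivative_real_field simp: k)
    then show "((\<lambda>x. exp (k * of_real x) / k) has_vector_derivative exp (k * of_real x)) (at x within {0..1/b})"
      using k by simp
  qed
  moreover have "exp (k * of_real (1/b)) = 1"
    using wave_int_eq_1[of "of_int m * b" "1/b"] b unfolding w by simp
  ultimately have I: "((wave (of_int m * b)) has_integral 0) {0..1/b}"
    by (simp add: w[abs_def])
  have "(LINT x|period_cell b. wave (of_int m * b) x) = integral {0..<1/b} (wave (of_int m * b))"
    by (rule lebesgue_integral_eq_integral) (auto intro!: integrable_period_cell[where C=1])
  also have "\<dots> = integral {0..1/b} (wave (of_int m * b))"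
    by (rule integral_spike_set) (auto intro: negligible_subset[of "{1/b}"])
  finally show ?thesis using I False by (simp add: integral_unique)
qed

text \<open>
  The Pythagorean identity for a trigonometric polynomial with arbitrary coefficients. Choosing
  \<open>a m = b * c m\<close> yields Bessel's inequality; dropping the last sum shows that an approximation of \<open>F\<close>
  forces the Fourier coefficients to carry almost all of its energy.
\<close>

lemma fourier_square_distance:
  fixes F :: "real \<Rightarrow> complex" and I :: "int set" and a :: "int \<Rightarrow> complex"
  assumes b: "b > 0" and F[measurable]: "F \<in> borel_measurable lebesgue"
    and C: "AE t in lebesgue. norm (F t) \<le> C" and I: "finite I"
  defines "c \<equiv> \<lambda>m. LINT x|period_cell b. F x * wave (- (of_int m * b)) x"
  defines "T \<equiv> \<lambda>x. \<Sum>m\<in>I. a m * wave (of_int m * b) x"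
  shows "(LINT x|period_cell b. (norm (F x - T x))\<^sup>2) =
     (LINT x|period_cell b. (norm (F x))\<^sup>2) - b * (\<Sum>m\<in>I. (norm (c m))\<^sup>2)
       + (\<Sum>m\<in>I. (norm (a m - of_real b * c m))\<^sup>2) / b"
proof -
  let ?M = "period_cell b"
  have T[measurable]: "T \<in> borel_measurable lebesgue" unfolding T_def by measurable
  have C': "AE t in ?M. norm (F t) \<le> C" using C by (rule AE_period_cell)
  have normT: "norm (T x) \<le> (\<Sum>m\<in>I. norm (a m))" for x
    unfolding T_def by (rule order_trans[OF norm_sum]) (simp add: norm_mult)
  have i1: "integrable ?M (\<lambda>x. (norm (F x))\<^sup>2)"
    by (rule integrable_period_cell[where C="C\<^sup>2"]) (use C' in \<open>auto elim!: eventually_mono intro: power_mono\<close>)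
  have i2: "integrable ?M (\<lambda>x. F x * wave (- (of_int m * b)) x)" for m
    by (rule integrable_period_cell[where C=C]) (use C' in \<open>auto simp: norm_mult\<close>)
  have FTx: "F x * cnj (T x) = (\<Sum>m\<in>I. cnj (a m) * (F x * wave (- (of_int m * b)) x))" for x
    by (simp add: T_def sum_distrib_left mult_ac)
  have i3: "integrable ?M (\<lambda>x. F x * cnj (T x))"
    unfolding FTx by (intro Bochner_Integration.integrable_sum integrable_mult_right i2)
  have i4: "integrable ?M (\<lambda>x. T x * cnj (T x))"
    by (rule integrable_period_cell[where C="(\<Sum>m\<in>I. norm (a m)) * (\<Sum>m\<in>I. norm (a m))"])
      (use normT in \<open>auto simp: norm_mult intro!: mult_mono sum_nonneg borel_measurable_times borel_measurable_cnj T\<close>)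
  have FT: "(LINT x|?M. F x * cnj (T x)) = (\<Sum>m\<in>I. cnj (a m) * c m)"
  proof -
    show ?thesis
      unfolding FTx using i2 by (simp add: c_def Bochner_Integration.integral_sum)
  qed
  have TT: "(LINT x|?M. T x * cnj (T x)) = (\<Sum>m\<in>I. of_real ((norm (a m))\<^sup>2 / b))"
  proof -
    have "T x * cnj (T x) = (\<Sum>m\<in>I. \<Sum>n\<in>I. (a m * cnj (a n)) * wave (of_int (m - n) * b) x)" for x
      unfolding T_def cnj_sum sum_product
      by (intro sum.cong refl) (simp add: wave_add[symmetric] algebra_simps flip: wave_add)
    then have "(LINT x|?M. T x * cnj (T x))
        = (LINT x|?M. (\<Sum>m\<in>I. \<Sum>n\<in>I. (a m * cnj (a n)) * wave (of_int (m - n) * b) x))"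
      by simp
    also have "\<dots> = (\<Sum>m\<in>I. \<Sum>n\<in>I. (a m * cnj (a n)) * (LINT x|?M. wave (of_int (m - n) * b) x))"
      by (subst Bochner_Integration.integral_sum | intro sum.cong refl Bochner_Integration.integrable_sum
          | auto intro!: integrable_period_cell[where C=1] integrable_mult_right simp del: of_int_diff)+
    also have "\<dots> = (\<Sum>m\<in>I. \<Sum>n\<in>I. if m = n then of_real ((norm (a m))\<^sup>2 / b) else 0)"
      unfolding integral_wave[OF b]
      by (intro sum.cong refl) (auto simp flip: complex_norm_square)
    also have "\<dots> = (\<Sum>m\<in>I. of_real ((norm (a m))\<^sup>2 / b))" using I by (simp add: sum.delta)
    finally show ?thesis .
  qed
  have "(LINT x|?M. (norm (F x - T x))\<^sup>2)
      = (LINT x|?M. (norm (F x))\<^sup>2 - 2 * Re (F x * cnj (T x)) + Re (T x * cnj (T x)))"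
    by (intro Bochner_Integration.integral_cong refl)
       (simp only: cmod_power2, simp add: power2_eq_square algebra_simps)
  also have "\<dots> = (LINT x|?M. (norm (F x))\<^sup>2) - 2 * Re (LINT x|?M. F x * cnj (T x)) + Re (LINT x|?M. T x * cnj (T x))"
  proof -
    have "(LINT x|?M. u x - 2 * Re (v x) + Re (w x)) = (LINT x|?M. u x) - 2 * Re (LINT x|?M. v x) + Re (LINT x|?M. w x)"
      if "integrable ?M u" "integrable ?M v" "integrable ?M w" for u :: "real \<Rightarrow> real" and v w
      using that by simp
    from this[OF i1 i3 i4] show ?thesis .
  qed
  also have "\<dots> = (LINT x|?M. (norm (F x))\<^sup>2) - 2 * (\<Sum>m\<in>I. Re (cnj (a m) * c m)) + (\<Sum>m\<in>I. (norm (a m))\<^sup>2 / b)"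
    unfolding FT TT by simp
  also have "\<dots> = (LINT x|?M. (norm (F x))\<^sup>2) - b * (\<Sum>m\<in>I. (norm (c m))\<^sup>2)
       + (\<Sum>m\<in>I. (norm (a m - of_real b * c m))\<^sup>2) / b"
  proof -
    \<comment> \<open>Completing the square: the waves have square norm \<open>1/b\<close> on a cell, so the best coefficient is \<open>b * c m\<close>.\<close>
    have "(norm (a m - of_real b * c m))\<^sup>2 / b = (norm (a m))\<^sup>2 / b - 2 * Re (cnj (a m) * c m) + b * (norm (c m))\<^sup>2" for m
      using b by (simp only: cmod_power2) (simp add: power2_eq_square field_simps)
    then show ?thesis
      by (simp add: sum_divide_distrib sum.distrib sum_subtractf sum_distrib_left)
  qed
  finally show ?thesis .
qed

lemma has_sum_nonneg_approx:
  fixes f :: "'a \<Rightarrow> real"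
  assumes "\<And>x. x \<in> A \<Longrightarrow> 0 \<le> f x"
    and le: "\<And>I. finite I \<Longrightarrow> I \<subseteq> A \<Longrightarrow> sum f I \<le> S"
    and ge: "\<And>e. e > 0 \<Longrightarrow> \<exists>I. finite I \<and> I \<subseteq> A \<and> S - e \<le> sum f I"
  shows "(f has_sum S) A"
proof -
  have bdd: "bdd_above (sum f ` {F. F \<subseteq> A \<and> finite F})" using le by (intro bdd_aboveI[of _ S]) auto
  have s: "(f has_sum (SUP F\<in>{F. finite F \<and> F\<subseteq>A}. sum f F)) A"
    by (rule nonneg_bdd_above_has_sum[OF assms(1) bdd])
  moreover have "(SUP F\<in>{F. finite F \<and> F\<subseteq>A}. sum f F) = S"
  proof (rule antisym)
    show "(SUP F\<in>{F. finite F \<and> F\<subseteq>A}. sum f F) \<le> S"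
      using le by (intro cSUP_least) auto
    show "S \<le> (SUP F\<in>{F. finite F \<and> F\<subseteq>A}. sum f F)"
    proof (rule field_le_epsilon)
      fix e :: real assume "e > 0"
      then obtain I where I: "finite I" "I \<subseteq> A" "S - e \<le> sum f I" using ge by blast
      have "sum f I \<le> (SUP F\<in>{F. finite F \<and> F\<subseteq>A}. sum f F)"
        using I bdd by (intro cSUP_upper) (auto simp: conj_commute)
      with I(3) show "S \<le> (SUP F\<in>{F. finite F \<and> F\<subseteq>A}. sum f F) + e" by simp
    qed
  qed
  ultimately show ?thesis by simp
qed

text \<open>
  Bessel's inequality is one half. For the other half, trigonometric polynomials that converge to \<open>F\<close>
  boundedly and almost everywhere also converge in mean square, so \<open>fourier_square_distance\<close> exhibits
  finite sets of frequencies whose energy is arbitrarily close to that of \<open>F\<close>.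
\<close>

lemma parseval:
  fixes F :: "real \<Rightarrow> complex"
  assumes b: "b > 0" and F[measurable]: "F \<in> borel_measurable lebesgue"
    and C: "AE t in lebesgue. norm (F t) \<le> C"
  shows "((\<lambda>m::int. (norm (LINT x|period_cell b. F x * wave (- (of_int m * b)) x))\<^sup>2)
      has_sum (LINT x|period_cell b. (norm (F x))\<^sup>2) / b) UNIV"
proof -
  let ?M = "period_cell b"
  define c where "c m = (LINT x|period_cell b. F x * wave (- (of_int m * b)) x)" for m :: int
  define C' where "C' = max 0 C"
  have C': "AE t in lebesgue. norm (F t) \<le> C'" "0 \<le> C'"
    using C unfolding C'_def by (auto elim: eventually_mono)
  obtain T where T: "\<And>n. trig_poly b (T n)"
    and Tb: "\<And>n t. t \<in> {0..1/b} \<Longrightarrow> norm (T n t) \<le> C' + 1"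
    and Tlim: "AE t in lebesgue. t \<in> {0<..<1/b} \<longrightarrow> (\<lambda>n. T n t) \<longlonglongrightarrow> F t"
    by (rule trig_poly_AE_approx[OF b F C']) blast
  note [measurable] = trig_poly_measurable[OF T]
  have "(\<lambda>n. LINT x|?M. (norm (F x - T n x))\<^sup>2) \<longlonglongrightarrow> (LINT x|?M. 0)"
  proof (rule integral_dominated_convergence)
    show "integrable ?M (\<lambda>x. (2 * C' + 1)\<^sup>2)"
      by (rule integrable_period_cell[where C="(2 * C' + 1)\<^sup>2"]) auto
    show "AE x in ?M. (\<lambda>n. (norm (F x - T n x))\<^sup>2) \<longlonglongrightarrow> 0"
    proof -
      have "AE x in ?M. x \<noteq> 0"
        by (rule AE_period_cell) (use AE_not_in[of "{0}" lebesgue] in \<open>simp add: negligible_iff_null_sets[symmetric]\<close>)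
      moreover have "AE x in ?M. x \<in> {0..<1/b}" by (auto simp: AE_restrict_space_iff)
      ultimately show ?thesis using AE_period_cell[OF Tlim, of b]
      proof eventually_elim
        case (elim x)
        then have "(\<lambda>n. T n x) \<longlonglongrightarrow> F x" by auto
        then have "(\<lambda>n. (norm (F x - T n x))\<^sup>2) \<longlonglongrightarrow> (norm (F x - F x))\<^sup>2"
          by (intro tendsto_intros)
        then show ?case by simp
      qed
    qed
    show "AE x in ?M. norm ((norm (F x - T n x))\<^sup>2) \<le> (2 * C' + 1)\<^sup>2" for n
    proof -
      have "AE x in ?M. x \<in> {0..<1/b}" by (auto simp: AE_restrict_space_iff)
      with AE_period_cell[OF C'(1), of b] show ?thesis
      proof eventually_elim
        case (elim x)
        have "norm (F x - T n x) \<le> norm (F x) + norm (T n x)" by (rule norm_triangle_ineq4)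
        also have "\<dots> \<le> C' + (C' + 1)" using elim Tb[of x n] by (intro add_mono) auto
        finally show ?case by (simp add: power_mono)
      qed
    qed
  qed (auto intro: measurable_restrict_space1)
  then have lim: "(\<lambda>n. LINT x|?M. (norm (F x - T n x))\<^sup>2) \<longlonglongrightarrow> 0" by simp
  have "((\<lambda>m. (norm (c m))\<^sup>2) has_sum (LINT x|?M. (norm (F x))\<^sup>2) / b) UNIV"
  proof (rule has_sum_nonneg_approx)
    fix I :: "int set" assume I: "finite I"
    have "0 \<le> (LINT x|?M. (norm (F x - (\<Sum>m\<in>I. (of_real b * c m) * wave (of_int m * b) x)))\<^sup>2)"
      by (rule integral_nonneg_AE) auto
    also have "\<dots> = (LINT x|?M. (norm (F x))\<^sup>2) - b * (\<Sum>m\<in>I. (norm (c m))\<^sup>2)"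
      unfolding fourier_square_distance[OF b F C I] by (simp add: c_def)
    finally show "(\<Sum>m\<in>I. (norm (c m))\<^sup>2) \<le> (LINT x|?M. (norm (F x))\<^sup>2) / b"
      using b by (simp add: field_simps)
  next
    fix e :: real assume "e > 0"
    then have "\<forall>\<^sub>F n in sequentially. (LINT x|?M. (norm (F x - T n x))\<^sup>2) < e * b"
      using lim b by (intro order_tendstoD) auto
    then obtain n where n: "(LINT x|?M. (norm (F x - T n x))\<^sup>2) < e * b"
      by (auto simp: eventually_sequentially)
    obtain I a where I: "finite I" and Tn: "T n = (\<lambda>t. \<Sum>m\<in>I. a m * wave (of_int m * b) t)"
      using trig_polyE[OF T] by metis
    have "(LINT x|?M. (norm (F x))\<^sup>2) - b * (\<Sum>m\<in>I. (norm (c m))\<^sup>2) \<le> (LINT x|?M. (norm (F x - T n x))\<^sup>2)"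
      unfolding Tn fourier_square_distance[OF b F C I] using b by (simp add: c_def sum_nonneg)
    with n have "(LINT x|?M. (norm (F x))\<^sup>2) / b - e \<le> (\<Sum>m\<in>I. (norm (c m))\<^sup>2)"
      using b by (simp add: field_simps)
    with I show "\<exists>I. finite I \<and> I \<subseteq> UNIV \<and> (LINT x|?M. (norm (F x))\<^sup>2) / b - e \<le> (\<Sum>m\<in>I. (norm (c m))\<^sup>2)"
      by blast
  qed simp
  then show ?thesis by (simp add: c_def)
qed

section \<open>Sums over the integers as integrals\<close>

text \<open>
  Unconditional sums are integrals against counting measure. The following lemmas set up this
  dictionary, so that interchanging sums and integrals becomes Tonelli's theorem and dominated
  convergence applies to sums.
\<close>

lemma integrable_count_space_iff_summable_on:
  fixes f :: "'a \<Rightarrow> 'b::{banach,second_countable_topology}"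
  shows "integrable (count_space A) f \<longleftrightarrow> (\<lambda>x. norm (f x)) summable_on A"
  using abs_summable_equivalent[of f A] by (simp add: Infinite_Set_Sum.abs_summable_on_def)

lemma infsum_eq_integral_count_space:
  fixes f :: "'a \<Rightarrow> 'b::{banach,second_countable_topology}"
  assumes "(\<lambda>x. norm (f x)) summable_on A"
  shows "infsum f A = (LINT x|count_space A. f x)"
  using infsetsum_infsum[of f A] abs_summable_equivalent[of f A] assms
  by (simp add: infsetsum_def)

lemma nn_integral_count_space_infsum:
  fixes u :: "'a \<Rightarrow> real"
  assumes "\<And>x. x \<in> A \<Longrightarrow> 0 \<le> u x" and "u summable_on A"
  shows "(\<integral>\<^sup>+x. ennreal (u x) \<partial>count_space A) = ennreal (infsum u A)"
proof -
  have *: "(\<lambda>x. norm (u x)) summable_on A"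
    using assms by (simp cong: summable_on_cong)
  then show ?thesis
    using assms by (subst nn_integral_eq_integral)
      (auto simp: integrable_count_space_iff_summable_on infsum_eq_integral_count_space AE_count_space)
qed

lemma summable_on_iff_nn_integral_finite:
  fixes u :: "'a \<Rightarrow> real"
  assumes "\<And>x. x \<in> A \<Longrightarrow> 0 \<le> u x"
  shows "u summable_on A \<longleftrightarrow> (\<integral>\<^sup>+x. ennreal (u x) \<partial>count_space A) < \<infinity>"
proof -
  have "u summable_on A \<longleftrightarrow> (\<lambda>x. norm (u x)) summable_on A"
    using assms by (intro summable_on_cong) auto
  also have "\<dots> \<longleftrightarrow> (\<integral>\<^sup>+x. ennreal (norm (u x)) \<partial>count_space A) < \<infinity>"
    by (subst integrable_count_space_iff_summable_on[symmetric]) (simp add: integrable_iff_bounded)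
  also have "(\<integral>\<^sup>+x. ennreal (norm (u x)) \<partial>count_space A) = (\<integral>\<^sup>+x. ennreal (u x) \<partial>count_space A)"
    using assms by (intro nn_integral_cong) auto
  finally show ?thesis .
qed

lemma infsum_le_of_nn_integral_le:
  fixes u :: "'a \<Rightarrow> real"
  assumes nn: "\<And>x. x \<in> A \<Longrightarrow> 0 \<le> u x" and B: "(\<integral>\<^sup>+x. ennreal (u x) \<partial>count_space A) \<le> ennreal B" "0 \<le> B"
  shows "u summable_on A \<and> infsum u A \<le> B"
proof -
  have s: "u summable_on A"
    using B(1) by (subst summable_on_iff_nn_integral_finite) (auto simp: nn le_less_trans[OF _ ennreal_less_top])
  with B show ?thesis using nn_integral_count_space_infsum[OF nn s] by simp
qed

text \<open>
  Dominated convergence for counting measure.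
\<close>

lemma tannery_infsum:
  fixes R :: "nat \<Rightarrow> 'a::countable \<Rightarrow> complex"
  assumes "\<And>k. (\<lambda>N. R N k) \<longlonglongrightarrow> r k" and "\<And>N k. norm (R N k) \<le> M k" and "M summable_on UNIV"
  shows "(\<lambda>N. infsum (R N) UNIV) \<longlonglongrightarrow> infsum r UNIV"
proof -
  have r: "norm (r k) \<le> M k" for k
    by (rule LIMSEQ_le_const2[OF tendsto_norm[OF assms(1)]]) (use assms(2) in auto)
  have "(\<lambda>N. LINT k|count_space UNIV. R N k) \<longlonglongrightarrow> (LINT k|count_space UNIV. r k)"
  proof (rule integral_dominated_convergence)
    have "0 \<le> M k" for k using r[of k] norm_ge_zero order_trans by blast
    then show "integrable (count_space UNIV) M"
      using assms(3) by (simp add: integrable_count_space_iff_summable_on)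
  qed (use assms in auto)
  moreover have "(\<lambda>k. norm (R N k)) summable_on UNIV" "(\<lambda>k. norm (r k)) summable_on UNIV" for N
    by (rule summable_on_comparison_test[OF assms(3)]; use assms(2) r in simp)+
  ultimately show ?thesis by (simp add: infsum_eq_integral_count_space)
qed

text \<open>
  Enumerating the integers makes visible that a pointwise infinite sum of measurable functions is
  measurable, including on the set where the sum diverges and takes its default value 0.
\<close>

lemma infsum_int_eq_suminf:
  fixes h :: "int \<Rightarrow> complex"
  shows "infsum h UNIV =
    (if (\<integral>\<^sup>+n. ennreal (norm (h n)) \<partial>count_space UNIV) < \<infinity> then \<Sum>i. h (int_decode i) else 0)"
proof (cases "h summable_on UNIV")
  case True
  then have s: "(\<lambda>n. norm (h n)) summable_on UNIV" by (simp add: summable_on_iff_abs_summable_on_complex)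
  have "(h \<circ> int_decode) summable_on UNIV"
    using True by (simp add: summable_on_reindex_bij_betw[OF bij_int_decode] o_def)
  then have "(\<lambda>i. h (int_decode i)) sums infsum (\<lambda>i. h (int_decode i)) UNIV"
    by (simp add: o_def has_sum_imp_sums)
  then have "(\<Sum>i. h (int_decode i)) = infsum h UNIV"
    by (simp add: sums_iff infsum_reindex_bij_betw[OF bij_int_decode])
  moreover have "(\<integral>\<^sup>+n. ennreal (norm (h n)) \<partial>count_space UNIV) < \<infinity>"
    using s by (subst summable_on_iff_nn_integral_finite[symmetric]) auto
  ultimately show ?thesis by simp
next
  case False
  then have "\<not> (\<lambda>n. norm (h n)) summable_on UNIV" by (simp add: summable_on_iff_abs_summable_on_complex)
  then have "\<not> (\<integral>\<^sup>+n. ennreal (norm (h n)) \<partial>count_space UNIV) < \<infinity>"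
    by (subst summable_on_iff_nn_integral_finite[symmetric]) auto
  with False show ?thesis by (simp add: infsum_not_exists)
qed

lemma borel_measurable_nn_integral_int [measurable (raw)]:
  fixes u :: "int \<Rightarrow> 'a \<Rightarrow> ennreal"
  assumes "\<And>n. u n \<in> borel_measurable M"
  shows "(\<lambda>x. \<integral>\<^sup>+n. u n x \<partial>count_space UNIV) \<in> borel_measurable M"
proof -
  have "(\<integral>\<^sup>+n. u n x \<partial>count_space UNIV) = (\<Sum>i. u (int_decode i) x)" for x
    by (simp add: nn_integral_bij_count_space[OF bij_int_decode, symmetric] nn_integral_count_space_nat)
  then show ?thesis using assms by simp
qed

lemma borel_measurable_infsum_int [measurable (raw)]:
  fixes h :: "int \<Rightarrow> 'a \<Rightarrow> complex"
  assumes [measurable]: "\<And>n. h n \<in> borel_measurable M"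
  shows "(\<lambda>x. \<Sum>\<^sub>\<infinity>n. h n x) \<in> borel_measurable M"
  unfolding infsum_int_eq_suminf by measurable

text \<open>
  Fubini's theorem for a sum over the integers.
\<close>

lemma integral_infsum_int:
  fixes h :: "int \<Rightarrow> 'a \<Rightarrow> complex"
  assumes m[measurable]: "\<And>n. h n \<in> borel_measurable M"
    and fin: "(\<integral>\<^sup>+x. \<integral>\<^sup>+n. ennreal (norm (h n x)) \<partial>count_space UNIV \<partial>M) < \<infinity>"
  shows "((\<lambda>n. LINT x|M. h n x) has_sum (LINT x|M. (\<Sum>\<^sub>\<infinity>n. h n x))) UNIV"
proof -
  let ?d = int_decode
  have sw: "(\<integral>\<^sup>+x. \<integral>\<^sup>+n. ennreal (norm (h n x)) \<partial>count_space UNIV \<partial>M)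
      = (\<integral>\<^sup>+n. \<integral>\<^sup>+x. ennreal (norm (h n x)) \<partial>M \<partial>count_space UNIV)"
    by (rule nn_integral_count_space_nn_integral) auto
  have int: "integrable M (h n)" for n
  proof (rule integrableI_bounded)
    have "(\<integral>\<^sup>+x. ennreal (norm (h n x)) \<partial>M) \<le> (\<integral>\<^sup>+n. \<integral>\<^sup>+x. ennreal (norm (h n x)) \<partial>M \<partial>count_space UNIV)"
      by (rule nn_integral_ge_point) simp
    then show "(\<integral>\<^sup>+x. ennreal (norm (h n x)) \<partial>M) < \<infinity>" using fin sw by simp
  qed simp
  have ae: "AE x in M. (\<integral>\<^sup>+n. ennreal (norm (h n x)) \<partial>count_space UNIV) < \<infinity>"
    using nn_integral_PInf_AE[of "\<lambda>x. \<integral>\<^sup>+n. ennreal (norm (h n x)) \<partial>count_space UNIV" M] fin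
    by (auto simp: less_top)
  have ae': "AE x in M. summable (\<lambda>i. norm (h (?d i) x))"
    using ae
  proof eventually_elim
    case (elim x)
    then have "(\<lambda>n. norm (h n x)) summable_on UNIV" by (simp add: summable_on_iff_nn_integral_finite)
    then have "(\<lambda>i. norm (h (?d i) x)) summable_on UNIV"
      by (simp add: summable_on_reindex_bij_betw[OF bij_int_decode, of "\<lambda>n. norm (h n x)"])
    then show ?case by (rule summable_on_imp_summable)
  qed
  have "(\<lambda>n. LINT x|M. norm (h n x)) summable_on UNIV"
    using fin unfolding sw
    by (subst summable_on_iff_nn_integral_finite) (auto simp: nn_integral_eq_integral int)
  then have "(\<lambda>i. LINT x|M. norm (h (?d i) x)) summable_on UNIV"
    by (simp add: summable_on_reindex_bij_betw[OF bij_int_decode, of "\<lambda>n. LINT x|M. norm (h n x)"])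
  then have sm: "summable (\<lambda>i. LINT x|M. norm (h (?d i) x))" by (rule summable_on_imp_summable)
  have eq: "AE x in M. (\<Sum>i. h (?d i) x) = (\<Sum>\<^sub>\<infinity>n. h n x)"
    using ae by eventually_elim (simp add: infsum_int_eq_suminf)
  have "(\<lambda>i. LINT x|M. h (?d i) x) sums (LINT x|M. (\<Sum>i. h (?d i) x))" by (rule sums_integral[OF int ae' sm])
  also have "(LINT x|M. (\<Sum>i. h (?d i) x)) = (LINT x|M. (\<Sum>\<^sub>\<infinity>n. h n x))"
    using eq by (intro integral_cong_AE) auto
  finally have "((\<lambda>i. LINT x|M. h (?d i) x) has_sum (LINT x|M. (\<Sum>\<^sub>\<infinity>n. h n x))) UNIV"
    by (rule norm_summable_imp_has_sum[rotated])
       (rule summable_comparison_test'[OF sm], simp add: integral_norm_bound)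
  then show "((\<lambda>n. LINT x|M. h n x) has_sum (LINT x|M. (\<Sum>\<^sub>\<infinity>n. h n x))) UNIV"
    by (simp add: has_sum_reindex_bij_betw[OF bij_int_decode, of "\<lambda>n. LINT x|M. h n x"])
qed

section \<open>Translations and periodizations\<close>

lemma borel_measurable_lebesgue_ident [measurable]: "(\<lambda>x::real. x) \<in> borel_measurable lebesgue"
  by (rule measurable_completion) simp

lemma lebesgue_shift_measurable [measurable (raw)]:
  fixes f :: "real \<Rightarrow> 'a::topological_space"
  assumes "f \<in> borel_measurable lebesgue"
  shows "(\<lambda>x. f (x - c)) \<in> borel_measurable lebesgue"
proof -
  have "(\<lambda>x::real. - c + 1 * x) \<in> lebesgue \<rightarrow>\<^sub>M lebesgue"
    using lebesgue_affine_measurable[where c="\<lambda>x::real. 1" and t="- c"] by simp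
  from measurable_compose[OF this assms] show ?thesis by simp
qed

lemma nn_integral_lebesgue_shift:
  "f \<in> borel_measurable lebesgue \<Longrightarrow> (\<integral>\<^sup>+x. f (x - c) \<partial>lebesgue) = (\<integral>\<^sup>+x. f (x::real) \<partial>lebesgue)"
  using nn_integral_real_affine_lebesgue[of f 1 "- c"] by simp

lemma integrable_lebesgue_shift:
  fixes f :: "real \<Rightarrow> 'a::euclidean_space"
  shows "integrable lebesgue (\<lambda>x. f (x - c)) \<longleftrightarrow> integrable lebesgue f"
  using lebesgue_integrable_real_affine_iff[of 1 f "- c"] by simp

lemma integral_lebesgue_shift:
  fixes f :: "real \<Rightarrow> 'a::euclidean_space"
  shows "(LINT x|lebesgue. f (x - c)) = (LINT x|lebesgue. f x)"
  using lebesgue_integral_real_affine[of 1 f "- c"] by simp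

lemma AE_lebesgue_shift:
  assumes "AE x in lebesgue. P (x::real)"
  shows "AE x in lebesgue. P (x - c)"
proof -
  from assms obtain N where N: "N \<in> null_sets lebesgue" "{x. \<not> P x} \<subseteq> N"
    by (auto simp: eventually_ae_filter)
  have "negligible ((+) c ` N)" using N(1) negligible_iff_null_sets negligible_translation by blast
  then have "AE x in lebesgue. x \<notin> (+) c ` N" by (simp add: AE_not_in negligible_iff_null_sets)
  then show ?thesis
  proof eventually_elim
    case (elim x)
    then have "x - c \<notin> N" by (auto simp: image_iff)
    then show ?case using N(2) by blast
  qed
qed

lemma cell_unique:
  fixes p t :: real
  assumes "p > 0"
  shows "t + of_int k * p \<in> {0..<p} \<longleftrightarrow> k = - \<lfloor>t / p\<rfloor>"
proof -
  have "t + of_int k * p \<in> {0..<p} \<longleftrightarrow> \<lfloor>t / p\<rfloor> = - k"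
    using assms by (auto simp: floor_eq_iff field_simps)
  then show ?thesis by auto
qed

text \<open>
  The line is the disjoint union of the translates of one cell, and all of them can be moved back to
  that cell because Lebesgue measure is translation invariant.
\<close>

lemma nn_integral_unfold:
  fixes h :: "real \<Rightarrow> ennreal"
  assumes p: "p > 0" and [measurable]: "h \<in> borel_measurable lebesgue"
  shows "(\<integral>\<^sup>+x. h x \<partial>lebesgue)
    = (\<integral>\<^sup>+x. (\<integral>\<^sup>+(k::int). h (x - of_int k * p) \<partial>count_space UNIV) * indicator {0..<p} x \<partial>lebesgue)"
proof -
  have one: "(\<integral>\<^sup>+(k::int). indicator {0..<p} (x + of_int k * p) \<partial>count_space UNIV) = (1::ennreal)" for x
  proof -
    have "(\<integral>\<^sup>+(k::int). indicator {0..<p} (x + of_int k * p) \<partial>count_space UNIV)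
       = (\<integral>\<^sup>+(k::int). indicator {- \<lfloor>x / p\<rfloor>} k \<partial>count_space UNIV)"
      by (intro nn_integral_cong) (simp add: indicator_def cell_unique[OF p] del: atLeastLessThan_iff)
    then show ?thesis by simp
  qed
  have "(\<integral>\<^sup>+x. h x \<partial>lebesgue)
      = (\<integral>\<^sup>+x. (\<integral>\<^sup>+(k::int). h x * indicator {0..<p} (x + of_int k * p) \<partial>count_space UNIV) \<partial>lebesgue)"
    by (simp add: nn_integral_cmult one)
  also have "\<dots> = (\<integral>\<^sup>+(k::int). (\<integral>\<^sup>+x. h x * indicator {0..<p} (x + of_int k * p) \<partial>lebesgue) \<partial>count_space UNIV)"
  proof (rule nn_integral_count_space_nn_integral)
    fix k :: int
    have "(\<lambda>x. indicator {0..<p} (x - (- of_int k * p)) :: ennreal) \<in> borel_measurable lebesgue"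
      by (rule lebesgue_shift_measurable) measurable
    then show "(\<lambda>x. h x * indicator {0..<p} (x + of_int k * p)) \<in> borel_measurable lebesgue" by simp
  qed simp
  also have "\<dots> = (\<integral>\<^sup>+(k::int). (\<integral>\<^sup>+x. h (x - of_int k * p) * indicator {0..<p} x \<partial>lebesgue) \<partial>count_space UNIV)"
  proof (rule nn_integral_cong)
    fix k :: int
    have "(\<lambda>x. h (x - of_int k * p) * indicator {0..<p} x) \<in> borel_measurable lebesgue" by measurable
    from nn_integral_lebesgue_shift[OF this, of "- of_int k * p"]
    show "(\<integral>\<^sup>+x. h x * indicator {0..<p} (x + of_int k * p) \<partial>lebesgue)
        = (\<integral>\<^sup>+x. h (x - of_int k * p) * indicator {0..<p} x \<partial>lebesgue)" by simp
  qed
  also have "\<dots> = (\<integral>\<^sup>+x. (\<integral>\<^sup>+(k::int). h (x - of_int k * p) * indicator {0..<p} x \<partial>count_space UNIV) \<partial>lebesgue)"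
    by (rule nn_integral_count_space_nn_integral[symmetric]) auto
  finally show ?thesis by (simp add: nn_integral_multc)
qed

text \<open>
  By unfolding, the periodization has finite integral over one cell, hence is finite almost everywhere
  there; being periodic, it is finite almost everywhere on the line.
\<close>

lemma AE_periodization_finite:
  fixes h :: "real \<Rightarrow> ennreal"
  assumes p: "p > 0" and h[measurable]: "h \<in> borel_measurable lebesgue" and fin: "(\<integral>\<^sup>+x. h x \<partial>lebesgue) < \<infinity>"
  shows "AE x in lebesgue. (\<integral>\<^sup>+(k::int). h (x - of_int k * p) \<partial>count_space UNIV) < \<infinity>"
proof -
  define H where "H x = (\<integral>\<^sup>+(k::int). h (x - of_int k * p) \<partial>count_space UNIV)" for x
  have [measurable]: "H \<in> borel_measurable lebesgue" unfolding H_def by measurable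
  have per: "H (x - of_int j * p) = H x" for x and j :: int
  proof -
    have "bij (\<lambda>k. j + k)" by (rule bij_plus)
    from nn_integral_bij_count_space[OF this, of "\<lambda>k. h (x - of_int k * p)"]
    show ?thesis by (simp add: H_def algebra_simps)
  qed
  have "(\<integral>\<^sup>+x. H x * indicator {0..<p} x \<partial>lebesgue) < \<infinity>"
    using fin nn_integral_unfold[OF p h] by (simp add: H_def)
  then have "AE x in lebesgue. H x * indicator {0..<p} x \<noteq> \<infinity>"
    by (intro nn_integral_PInf_AE) auto
  then have "AE x in lebesgue. H (x - of_int j * p) * indicator {0..<p} (x - of_int j * p) \<noteq> \<infinity>" for j :: int
    by (rule AE_lebesgue_shift)
  then have "AE x in lebesgue. \<forall>j::int. H (x - of_int j * p) * indicator {0..<p} (x - of_int j * p) \<noteq> \<infinity>"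
    by (intro AE_all_countable[THEN iffD2] allI)
  then show ?thesis
  proof eventually_elim
    case (elim x)
    have "x - of_int \<lfloor>x / p\<rfloor> * p \<in> {0..<p}" using cell_unique[OF p, of x "- \<lfloor>x / p\<rfloor>"] by simp
    with elim[rule_format, of "\<lfloor>x / p\<rfloor>"] have "H x \<noteq> \<infinity>" by (simp add: per)
    then show ?case by (simp add: H_def less_top)
  qed
qed

section \<open>Energy of a sampled Fourier transform\<close>

lemma integrable_bounded_support:
  fixes u :: "real \<Rightarrow> complex"
  assumes "u \<in> borel_measurable lebesgue" "AE x in lebesgue. norm (u x) \<le> C" "\<And>x. R < \<bar>x\<bar> \<Longrightarrow> u x = 0"
  shows "integrable lebesgue u"
proof (rule Bochner_Integration.integrable_bound)
  have "emeasure lebesgue {- R..R} < \<infinity>" by (cases "- R \<le> R") auto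
  then show "integrable lebesgue (\<lambda>x. C * indicator {- R..R} x)"
    by (intro integrable_mult_right integrable_real_indicator) auto
  show "AE x in lebesgue. norm (u x) \<le> norm (C * indicator {- R..R} x)"
    using assms(2)
  proof eventually_elim
    case (elim x)
    then show ?case using assms(3)[of x] by (cases "R < \<bar>x\<bar>") (auto simp: indicator_def abs_le_iff)
  qed
qed fact

lemma integral_period_cell_indicator:
  fixes u :: "real \<Rightarrow> complex"
  shows "(LINT x|period_cell b. u x) = (LINT x|lebesgue. indicator {0..<1/b} x *\<^sub>R u x)"
  by (rule integral_restrict_space) simp

text \<open>
  For a function of bounded support only finitely many translates meet the cell, so that unfolding is
  a finite sum and applies to complex-valued integrands.
\<close>

lemma integral_finite_unfold:
  fixes u :: "real \<Rightarrow> complex"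
  assumes b: "b > 0" and u: "integrable lebesgue u"
    and K: "finite K" "\<And>x k. u x \<noteq> 0 \<Longrightarrow> x + of_int k / b \<in> {0..<1/b} \<Longrightarrow> k \<in> K"
  shows "(LINT x|lebesgue. u x) = (\<Sum>k\<in>K. LINT x|period_cell b. u (x - of_int k / b))"
proof -
  have "u x = (\<Sum>k\<in>K. indicator {0..<1/b} (x + of_int k / b) *\<^sub>R u x)" for x
  proof (cases "u x = 0")
    case False
    let ?k = "- \<lfloor>x * b\<rfloor>"
    have cell: "x + of_int k / b \<in> {0..<1/b} \<longleftrightarrow> k = ?k" for k
      using cell_unique[of "1/b" x k] b by simp
    have "?k \<in> K" using K(2)[OF False, of ?k] cell[of ?k] by simp
    moreover have "indicator {0..<1/b} (x + of_int k / b) *\<^sub>R u x = (if k = ?k then u x else 0)" for k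
      using cell[of k] by (simp add: indicator_def del: atLeastLessThan_iff)
    ultimately show ?thesis using K(1) by (simp add: sum.delta')
  qed simp
  then have "(LINT x|lebesgue. u x) = (LINT x|lebesgue. (\<Sum>k\<in>K. indicator {0..<1/b} (x + of_int k / b) *\<^sub>R u x))"
    by simp
  also have "\<dots> = (\<Sum>k\<in>K. LINT x|lebesgue. indicator {0..<1/b} (x + of_int k / b) *\<^sub>R u x)"
  proof (rule Bochner_Integration.integral_sum)
    fix k
    have "integrable lebesgue (\<lambda>x. indicator {0..<1/b} x *\<^sub>R u (x - of_int k / b))"
      using u by (intro integrable_mult_indicator) (simp_all add: integrable_lebesgue_shift)
    from this[THEN integrable_lebesgue_shift[where c="- of_int k / b", THEN iffD2]]
    show "integrable lebesgue (\<lambda>x. indicator {0..<1/b} (x + of_int k / b) *\<^sub>R u x)" by simp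
  qed
  also have "\<dots> = (\<Sum>k\<in>K. LINT x|period_cell b. u (x - of_int k / b))"
  proof (intro sum.cong refl)
    fix k
    show "(LINT x|lebesgue. indicator {0..<1/b} (x + of_int k / b) *\<^sub>R u x) = (LINT x|period_cell b. u (x - of_int k / b))"
      unfolding integral_period_cell_indicator
      using integral_lebesgue_shift[of "\<lambda>x. indicator {0..<1/b} x *\<^sub>R u (x - of_int k / b)" "- of_int k / b"] by simp
  qed
  finally show ?thesis .
qed

lemma wave_shift_period:
  assumes "b > 0"
  shows "wave (of_int m * b) (x - of_int k / b) = wave (of_int m * b) x"
proof -
  have "wave (- (of_int m * b)) (of_int k / b) = 1"
    using assms by (intro wave_int_eq_1) simp
  then show ?thesis by (simp add: wave_diff_right)
qed

text \<open>
  This is Poisson summation for the autocorrelation of \<open>h\<close>. The samples are the Fourier coefficients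
  of the periodization \<open>F\<close> of \<open>h\<close>, and Parseval's identity expresses their energy as the integral of
  \<open>cnj F * F\<close> over a cell. Unfolding only the first factor turns this into the integral of \<open>cnj h * F\<close>
  over the line, which is the sum of the autocorrelations of \<open>h\<close> at the points \<open>k/b\<close>.
  The bounded support makes all sums over translates finite.
\<close>

lemma sampled_fourier_autocorrelation:
  fixes h :: "real \<Rightarrow> complex"
  assumes b: "b > 0" and h[measurable]: "h \<in> borel_measurable lebesgue"
    and C: "AE x in lebesgue. norm (h x) \<le> C" and R: "\<And>x. R < \<bar>x\<bar> \<Longrightarrow> h x = 0"
    and K: "finite K" "\<And>k. \<bar>of_int k / b\<bar> \<le> 2 * R \<Longrightarrow> k \<in> K"
  shows "((\<lambda>m::int. of_real ((norm (LINT x|lebesgue. h x * wave (- (of_int m * b)) x))\<^sup>2) :: complex)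
      has_sum 1 / of_real b * (\<Sum>k\<in>K. LINT x|lebesgue. cnj (h x) * h (x - of_int k / b))) UNIV"
proof -
  let ?M = "period_cell b"
  \<comment> \<open>The translates that bring a point of \<open>[- R, R]\<close> into the cell \<open>[0, 1/b)\<close> have index at most \<open>R * b + 1\<close> in modulus.\<close>
  define L :: int where "L = \<lceil>R * b\<rceil> + 1"
  define J where "J = {- L..L}"
  have J: "finite J" by (simp add: J_def)
  have J': "k \<in> J" if "\<bar>x\<bar> \<le> R" "x + of_int k / b \<in> {0..<1/b}" for x k
  proof -
    have "\<bar>of_int k / b\<bar> \<le> R + 1 / b" using that by auto
    then have "\<bar>of_int k\<bar> \<le> R * b + 1" using b by (simp add: abs_divide field_simps)
    then have "\<bar>of_int k\<bar> \<le> (of_int L :: real)" unfolding L_def by linarith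
    then show ?thesis by (auto simp: J_def)
  qed
  have hR: "\<bar>x\<bar> \<le> R" if "h x \<noteq> 0" for x using R[of x] that by linarith
  define F where "F x = (\<Sum>k\<in>J. h (x - of_int k / b))" for x
  \<comment> \<open>\<open>E\<close> agrees with the full periodization on the support of \<open>h\<close>; it only uses the differences in \<open>K\<close>.\<close>
  define E where "E x = (\<Sum>k\<in>K. h (x - of_int k / b))" for x
  have C0: "AE x in lebesgue. \<forall>k::int. norm (h (x - of_int k / b)) \<le> C"
    unfolding AE_all_countable using AE_lebesgue_shift[OF C] by blast
  have Fm[measurable]: "F \<in> borel_measurable lebesgue" unfolding F_def by measurable
  have Em[measurable]: "E \<in> borel_measurable lebesgue" unfolding E_def by measurable
  have FC: "AE x in lebesgue. norm (F x) \<le> real (card J) * C"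
    using C0 by eventually_elim (auto simp: F_def intro!: sum_norm_bound)
  have EC: "AE x in lebesgue. norm (E x) \<le> real (card K) * C"
    using C0 by eventually_elim (auto simp: E_def intro!: sum_norm_bound)
  have hint: "integrable lebesgue (\<lambda>x. h x * w x)"
    if w: "w \<in> borel_measurable lebesgue" "AE x in lebesgue. norm (w x) \<le> D" for w D
  proof (rule integrable_bounded_support)
    show "(\<lambda>x. h x * w x) \<in> borel_measurable lebesgue" using w(1) by measurable
    show "AE x in lebesgue. norm (h x * w x) \<le> C * D"
      using C w(2)
    proof eventually_elim
      case (elim x)
      have "0 \<le> C" using elim(1) norm_ge_zero order_trans by blast
      with elim show ?case by (simp add: norm_mult mult_mono)
    qed
  qed (use R in auto)
  have Fint: "integrable ?M (\<lambda>x. h (x - of_int k / b) * w x)"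
    if w[measurable]: "w \<in> borel_measurable lebesgue" and wD: "AE x in lebesgue. norm (w x) \<le> D" for w D k
  proof (rule integrable_period_cell)
    show "(\<lambda>x. h (x - of_int k / b) * w x) \<in> borel_measurable lebesgue" by measurable
    have "AE x in lebesgue. norm (h (x - of_int k / b) * w x) \<le> C * D"
      using C0 wD
    proof eventually_elim
      case (elim x)
      have "norm (h (x - of_int k / b)) \<le> C" using elim(1) by blast
      moreover from this have "0 \<le> C" using norm_ge_zero order_trans by blast
      ultimately show ?case using elim by (simp add: norm_mult mult_mono)
    qed
    then show "AE x in ?M. norm (h (x - of_int k / b) * w x) \<le> C * D" by (rule AE_period_cell)
  qed
  \<comment> \<open>Sampling the transform of \<open>h\<close> at multiples of \<open>b\<close> only sees the periodization \<open>F\<close>.\<close>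
  have coeff: "(LINT x|?M. F x * wave (- (of_int m * b)) x) = (LINT x|lebesgue. h x * wave (- (of_int m * b)) x)" for m :: int
  proof -
    have "(LINT x|lebesgue. h x * wave (- (of_int m * b)) x)
        = (\<Sum>k\<in>J. LINT x|?M. h (x - of_int k / b) * wave (- (of_int m * b)) (x - of_int k / b))"
      by (rule integral_finite_unfold[OF b _ J]) (auto intro!: hint[where D=1] J' hR)
    also have "\<dots> = (\<Sum>k\<in>J. LINT x|?M. h (x - of_int k / b) * wave (- (of_int m * b)) x)"
      using wave_shift_period[OF b, of "- m"] by simp
    also have "\<dots> = (LINT x|?M. F x * wave (- (of_int m * b)) x)"
      unfolding F_def sum_distrib_right
      by (rule Bochner_Integration.integral_sum[symmetric]) (auto intro!: Fint[where D=1])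
    finally show ?thesis by simp
  qed
  have FE: "cnj (h (x - of_int k / b)) * E (x - of_int k / b) = cnj (h (x - of_int k / b)) * F x"
    if x: "x \<in> {0..<1/b}" for x k
  proof (cases "h (x - of_int k / b) = 0")
    case False
    have "E (x - of_int k / b) = (\<Sum>j\<in>(+) k ` K. h (x - of_int j / b))"
      unfolding E_def by (subst sum.reindex) (auto simp: add_divide_distrib algebra_simps)
    also have "\<dots> = (\<Sum>j\<in>(+) k ` K \<union> J. h (x - of_int j / b))"
    proof (rule sum.mono_neutral_left)
      show "\<forall>j\<in>(+) k ` K \<union> J - (+) k ` K. h (x - of_int j / b) = 0"
      proof (rule ballI, rule ccontr)
        fix j assume j: "j \<in> (+) k ` K \<union> J - (+) k ` K" "h (x - of_int j / b) \<noteq> 0"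
        have "\<bar>(x - of_int k / b) - (x - of_int j / b)\<bar> \<le> R + R"
          using hR[OF False] hR[OF j(2)] by linarith
        then have "j - k \<in> K" using K(2)[of "j - k"] by (simp add: diff_divide_distrib)
        then have "j \<in> (+) k ` K" by (intro image_eqI[of _ _ "j - k"]) auto
        with j(1) show False by simp
      qed
    qed (use J K in auto)
    also have "\<dots> = F x"
      unfolding F_def
    proof (rule sum.mono_neutral_right)
      show "\<forall>j\<in>(+) k ` K \<union> J - J. h (x - of_int j / b) = 0"
        using J'[of "x - of_int j / b" j for j] hR x by auto
    qed (use J K in auto)
    finally show ?thesis by simp
  qed simp
  have "of_real (LINT x|?M. (norm (F x))\<^sup>2) = (LINT x|?M. cnj (F x) * F x)"
    by (subst integral_complex_of_real[symmetric]) (simp only: complex_norm_square mult.commute)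
  also have "\<dots> = (\<Sum>k\<in>J. LINT x|?M. cnj (h (x - of_int k / b)) * F x)"
  proof -
    have "integrable ?M (\<lambda>x. cnj (h (x - of_int k / b)) * F x)" for k
    proof -
      have "integrable ?M (\<lambda>x. cnj (h (x - of_int k / b) * cnj (F x)))"
        by (intro integrable_cnj Fint[where D="real (card J) * C"]) (use FC in auto)
      then show ?thesis by simp
    qed
    then show ?thesis
      by (subst (1) F_def) (simp add: sum_distrib_right Bochner_Integration.integral_sum)
  qed
  also have "\<dots> = (\<Sum>k\<in>J. LINT x|?M. cnj (h (x - of_int k / b)) * E (x - of_int k / b))"
    by (intro sum.cong refl Bochner_Integration.integral_cong) (auto simp: FE)
  also have "\<dots> = (LINT x|lebesgue. cnj (h x) * E x)"
  proof (rule integral_finite_unfold[symmetric, OF b _ J])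
    have "integrable lebesgue (\<lambda>x. cnj (h x * cnj (E x)))"
      by (intro integrable_cnj hint[where D="real (card K) * C"]) (use EC in auto)
    then show "integrable lebesgue (\<lambda>x. cnj (h x) * E x)" by simp
  qed (auto intro: J' hR)
  also have "\<dots> = (\<Sum>k\<in>K. LINT x|lebesgue. cnj (h x) * h (x - of_int k / b))"
  proof -
    have "integrable lebesgue (\<lambda>x. cnj (h x) * h (x - of_int k / b))" for k
    proof -
      have "AE x in lebesgue. norm (cnj (h (x - of_int k / b))) \<le> C"
        using C0 by eventually_elim simp
      then have "integrable lebesgue (\<lambda>x. cnj (h x * cnj (h (x - of_int k / b))))"
        by (intro integrable_cnj hint) measurable
      then show ?thesis by simp
    qed
    then show ?thesis by (simp add: E_def sum_distrib_left Bochner_Integration.integral_sum)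
  qed
  finally have energy: "of_real (LINT x|?M. (norm (F x))\<^sup>2) = (\<Sum>k\<in>K. LINT x|lebesgue. cnj (h x) * h (x - of_int k / b))" .
  have "((\<lambda>m::int. of_real ((norm (LINT x|lebesgue. h x * wave (- (of_int m * b)) x))\<^sup>2) :: complex)
      has_sum of_real ((LINT x|?M. (norm (F x))\<^sup>2) / b)) UNIV"
    using has_sum_of_real[OF parseval[OF b Fm FC]] unfolding coeff .
  also have "of_real ((LINT x|?M. (norm (F x))\<^sup>2) / b) = 1 / of_real b * (\<Sum>k\<in>K. LINT x|lebesgue. cnj (h x) * h (x - of_int k / b))"
    unfolding energy[symmetric] by simp
  finally show ?thesis .
qed

section \<open>The window under the CC-condition\<close>

lemma lebesgue_shift2_measurable [measurable (raw)]:
  fixes f :: "real \<Rightarrow> 'a::topological_space"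
  assumes "f \<in> borel_measurable lebesgue"
  shows "(\<lambda>x. f (x - c - d)) \<in> borel_measurable lebesgue"
  using lebesgue_shift_measurable[OF assms, of "c + d"] by (simp add: diff_diff_eq)

lemma L2D:
  assumes "f \<in> L2"
  shows "f \<in> borel_measurable lebesgue" "integrable lebesgue (\<lambda>x. (norm (f x))\<^sup>2)"
  using assms by (auto simp: L2_def)

lemma nn_integral_L2:
  assumes "f \<in> L2"
  shows "(\<integral>\<^sup>+x. ennreal ((norm (f x))\<^sup>2) \<partial>lebesgue) = ennreal (LINT x|lebesgue. (norm (f x))\<^sup>2)"
  using L2D[OF assms] by (intro nn_integral_eq_integral) auto

lemma G_measurable:
  assumes [measurable]: "g \<in> borel_measurable lebesgue"
  shows "G g a b k \<in> borel_measurable lebesgue"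
  unfolding G_def by measurable

lemma norm_mult_le_half_squares: "norm (x * y) \<le> ((norm x)\<^sup>2 + (norm y)\<^sup>2) / 2"
  for x y :: "'a::real_normed_div_algebra"
  using sum_squares_bound[of "norm x" "norm y"] by (simp add: norm_mult)

lemma ennreal_le_half_sum:
  assumes "x \<le> (u + v) / 2" "0 \<le> u" "0 \<le> v"
  shows "ennreal x \<le> ennreal (1/2) * ennreal u + ennreal (1/2) * ennreal v"
proof -
  have "ennreal x \<le> ennreal (1/2 * u + 1/2 * v)" using assms by (intro ennreal_leI) simp
  also have "\<dots> = ennreal (1/2 * u) + ennreal (1/2 * v)" using assms by (intro ennreal_plus) auto
  also have "\<dots> = ennreal (1/2) * ennreal u + ennreal (1/2) * ennreal v"
    using assms by (intro arg_cong2[where f="(+)"] ennreal_mult) auto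
  finally show ?thesis .
qed

lemma ennreal_half_plus_half: "ennreal (1/2) * x + ennreal (1/2) * x = x"
proof -
  have "ennreal (1/2) + ennreal (1/2) = 1"
    by (subst ennreal_plus[symmetric]) (auto simp del: ennreal_plus)
  then show ?thesis by (simp only: distrib_right[symmetric] mult_1)
qed

lemma has_sum_finite_sum:
  fixes f :: "'i \<Rightarrow> 'a \<Rightarrow> 'b::topological_comm_monoid_add"
  shows "finite K \<Longrightarrow> (\<And>k. k \<in> K \<Longrightarrow> (f k has_sum s k) A) \<Longrightarrow> ((\<lambda>x. \<Sum>k\<in>K. f k x) has_sum (\<Sum>k\<in>K. s k)) A"
  by (induction K rule: finite_induct) (auto intro: has_sum_add has_sum_0)

text \<open>
  Translating by \<open>k/b\<close> exchanges the two factors of every summand. Hence the weights with which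
  \<open>\<bar>f(t)\<bar>\<^sup>2\<close> and \<open>\<bar>f(t - k/b)\<bar>\<^sup>2\<close> enter the estimate of the right-hand side are the same after
  replacing \<open>k\<close> by \<open>- k\<close>.
\<close>

lemma G_shift: "G g a b k (t + of_int k / b) = cnj (G g a b (- k) t)"
  unfolding G_def by (subst infsum_cnj[symmetric], rule infsum_cong) (simp add: algebra_simps)

text \<open>
  The constant of the CC-condition is a parameter, so that the estimates below can refer to it. It may
  be taken nonnegative because it bounds sums of norms.
\<close>

locale CC_system =
  fixes a b B :: real and g :: "real \<Rightarrow> complex"
  assumes a: "a > 0" and b: "b > 0" and B: "B \<ge> 0" and g: "g \<in> L2"
    and CC: "AE t in lebesgue.
        (\<lambda>k. norm (G g a b k t)) summable_on UNIV \<and> (\<Sum>\<^sub>\<infinity>k. norm (G g a b k t)) \<le> B"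
begin

lemma g_measurable [measurable]: "g \<in> borel_measurable lebesgue"
  using L2D[OF g] by simp

lemma G_meas [measurable]: "G g a b k \<in> borel_measurable lebesgue"
  by (rule G_measurable) measurable

lemma nn_CC: "AE t in lebesgue. (\<integral>\<^sup>+k. ennreal (norm (G g a b k t)) \<partial>count_space UNIV) \<le> ennreal B"
  using CC by eventually_elim (auto simp: nn_integral_count_space_infsum ennreal_leI)

text \<open>
  The periodization of \<open>\<bar>g\<bar>\<^sup>2\<close> is the function \<open>G g a b 0\<close> wherever it is finite, which is almost everywhere
  because \<open>g\<close> is square integrable. This finiteness has to be shown first: where the series diverges,
  \<open>G\<close> has the value 0 and the CC-condition says nothing about it.
\<close>

lemma periodization_bound:
  "AE t in lebesgue. (\<integral>\<^sup>+(n::int). ennreal ((norm (g (t - of_int n * a)))\<^sup>2) \<partial>count_space UNIV) \<le> ennreal B"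
proof -
  have "AE t in lebesgue. (\<integral>\<^sup>+(n::int). ennreal ((norm (g (t - of_int n * a)))\<^sup>2) \<partial>count_space UNIV) < \<infinity>"
    using AE_periodization_finite[OF a, of "\<lambda>x. ennreal ((norm (g x))\<^sup>2)"] nn_integral_L2[OF g] by simp
  with CC show ?thesis
  proof eventually_elim
    case (elim t)
    have s: "(\<lambda>n::int. (norm (g (t - of_int n * a)))\<^sup>2) summable_on UNIV"
      using elim(2) by (subst summable_on_iff_nn_integral_finite) auto
    have "G g a b 0 t = (\<Sum>\<^sub>\<infinity>n::int. of_real ((norm (g (t - of_int n * a)))\<^sup>2))"
      unfolding G_def by (intro infsum_cong) (simp flip: complex_norm_square)
    also have "\<dots> = of_real (\<Sum>\<^sub>\<infinity>n::int. (norm (g (t - of_int n * a)))\<^sup>2)"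
      using s by (intro infsumI has_sum_of_real has_sum_infsum)
    finally have "(\<Sum>\<^sub>\<infinity>n::int. (norm (g (t - of_int n * a)))\<^sup>2) = norm (G g a b 0 t)"
      by (simp add: infsum_nonneg)
    also have "\<dots> \<le> (\<Sum>\<^sub>\<infinity>k. norm (G g a b k t))"
      using finite_sum_le_infsum[of "\<lambda>k. norm (G g a b k t)" UNIV "{0}"] elim(1) by simp
    finally show ?case using elim(1) s by (simp add: nn_integral_count_space_infsum ennreal_leI)
  qed
qed

lemma g_bounded: "AE t in lebesgue. norm (g t) \<le> sqrt B"
  using periodization_bound
proof eventually_elim
  case (elim t)
  have "ennreal ((norm (g (t - of_int 0 * a)))\<^sup>2) \<le> ennreal B"
    by (rule order_trans[OF nn_integral_ge_point elim]) simp
  then show ?case using B by (simp add: real_le_rsqrt)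
qed

text \<open>
  The arithmetic-geometric mean inequality reduces this to the periodization of \<open>\<bar>g\<bar>\<^sup>2\<close> at \<open>t\<close> and
  at \<open>t - c\<close>.
\<close>

lemma correlation_bound:
  "AE t in lebesgue. (\<integral>\<^sup>+(n::int). ennreal (norm (g (t - of_int n * a) * cnj (g (t - of_int n * a - c)))) \<partial>count_space UNIV) \<le> ennreal B"
  using periodization_bound AE_lebesgue_shift[OF periodization_bound, of c]
proof eventually_elim
  case (elim t)
  let ?u = "\<lambda>n::int. ennreal ((norm (g (t - of_int n * a)))\<^sup>2)" and ?v = "\<lambda>n::int. ennreal ((norm (g (t - c - of_int n * a)))\<^sup>2)"
  have "(\<integral>\<^sup>+(n::int). ennreal (norm (g (t - of_int n * a) * cnj (g (t - of_int n * a - c)))) \<partial>count_space UNIV)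
     \<le> (\<integral>\<^sup>+n. ennreal (1/2) * ?u n + ennreal (1/2) * ?v n \<partial>count_space UNIV)"
  proof (rule nn_integral_mono)
    fix n :: int
    have swap: "t - c - of_int n * a = t - of_int n * a - c" by simp
    show "ennreal (norm (g (t - of_int n * a) * cnj (g (t - of_int n * a - c)))) \<le> ennreal (1/2) * ?u n + ennreal (1/2) * ?v n"
      unfolding swap
      by (rule ennreal_le_half_sum)
        (use norm_mult_le_half_squares[of "g (t - of_int n * a)" "cnj (g (t - of_int n * a - c))"] in auto)
  qed
  also have "\<dots> = ennreal (1/2) * (\<integral>\<^sup>+n. ?u n \<partial>count_space UNIV) + ennreal (1/2) * (\<integral>\<^sup>+n. ?v n \<partial>count_space UNIV)"
    by (simp add: nn_integral_add nn_integral_cmult)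
  also have "\<dots> \<le> ennreal (1/2) * ennreal B + ennreal (1/2) * ennreal B"
    using elim by (intro add_mono mult_left_mono) auto
  also have "\<dots> = ennreal B"
    by (rule ennreal_half_plus_half)
  finally show ?case .
qed

section \<open>The identity for bounded functions of bounded support\<close>

definition coeff :: "(real \<Rightarrow> complex) \<Rightarrow> int \<times> int \<Rightarrow> complex" where
  "coeff f = (\<lambda>(m, n). L2_inner f (modulation (of_int m * b) (translation (of_int n * a) g)))"

lemma coeff_eq: "coeff f (m, n) = (LINT x|lebesgue. f x * cnj (g (x - of_int n * a)) * wave (- (of_int m * b)) x)"
  unfolding coeff_def L2_inner_def modulation_def translation_def wave_def[symmetric]
  by (simp add: mult_ac)

text \<open>
  The factors involving \<open>f\<close> do not depend on \<open>n\<close>, and what remains of the sum over \<open>n\<close> is \<open>G\<^sub>k\<close>. Summing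
  under the integral sign is legitimate because \<open>correlation_bound\<close> provides an integrable majorant.
\<close>

lemma rhs_term_has_sum:
  fixes f :: "real \<Rightarrow> complex"
  assumes [measurable]: "f \<in> borel_measurable lebesgue" and C: "\<And>x. norm (f x) \<le> C" and R: "\<And>x. R < \<bar>x\<bar> \<Longrightarrow> f x = 0"
  shows "((\<lambda>n::int. LINT t|lebesgue. cnj (f t * cnj (g (t - of_int n * a)))
       * (f (t - of_int k / b) * cnj (g (t - of_int k / b - of_int n * a)))) has_sum WH_rhs_term g a b f k) UNIV"
proof -
  define \<phi> where "\<phi> n t = cnj (f t) * f (t - of_int k / b) * (g (t - of_int n * a) * cnj (g (t - of_int n * a - of_int k / b)))"
    for n :: int and t
  have [measurable]: "\<phi> n \<in> borel_measurable lebesgue" for n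
    unfolding \<phi>_def by measurable
  have "integrable lebesgue (\<lambda>t. cnj (f t) * f (t - of_int k / b))"
    using C R by (intro integrable_bounded_support[where C="C * C" and R=R])
      (auto intro!: AE_I2 mult_mono order_trans[OF norm_ge_zero C] simp: norm_mult)
  then have fin: "(\<integral>\<^sup>+t. ennreal (norm (cnj (f t) * f (t - of_int k / b))) \<partial>lebesgue) < \<infinity>"
    by (simp add: integrable_iff_bounded)
  have "(\<integral>\<^sup>+t. \<integral>\<^sup>+n. ennreal (norm (\<phi> n t)) \<partial>count_space UNIV \<partial>lebesgue)
     \<le> (\<integral>\<^sup>+t. ennreal (norm (cnj (f t) * f (t - of_int k / b))) * ennreal B \<partial>lebesgue)"
  proof (rule nn_integral_mono_AE)
    show "AE t in lebesgue. (\<integral>\<^sup>+n. ennreal (norm (\<phi> n t)) \<partial>count_space UNIV)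
        \<le> ennreal (norm (cnj (f t) * f (t - of_int k / b))) * ennreal B"
      using correlation_bound[of "of_int k / b"]
    proof eventually_elim
      case (elim t)
      have "(\<integral>\<^sup>+n. ennreal (norm (\<phi> n t)) \<partial>count_space UNIV) = ennreal (norm (cnj (f t) * f (t - of_int k / b)))
          * (\<integral>\<^sup>+n. ennreal (norm (g (t - of_int n * a) * cnj (g (t - of_int n * a - of_int k / b)))) \<partial>count_space UNIV)"
        unfolding \<phi>_def norm_mult[of "cnj (f t) * f (t - of_int k / b)"]
        by (subst nn_integral_cmult[symmetric]) (simp_all add: ennreal_mult)
      then show ?case using elim by (simp add: mult_left_mono)
    qed
  qed
  also have "\<dots> < \<infinity>"
    using fin by (subst nn_integral_multc) (auto simp: ennreal_mult_less_top)
  finally have "((\<lambda>n. LINT t|lebesgue. \<phi> n t) has_sum (LINT t|lebesgue. (\<Sum>\<^sub>\<infinity>n. \<phi> n t))) UNIV"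
    by (intro integral_infsum_int) auto
  moreover have "(LINT t|lebesgue. (\<Sum>\<^sub>\<infinity>n. \<phi> n t)) = WH_rhs_term g a b f k"
    unfolding \<phi>_def infsum_cmult_right' WH_rhs_term_def G_def ..
  moreover have "cnj (f t * cnj (g (t - of_int n * a))) * (f (t - of_int k / b) * cnj (g (t - of_int k / b - of_int n * a))) = \<phi> n t" for n t
  proof -
    have swap: "t - of_int k / b - of_int n * a = t - of_int n * a - of_int k / b" by simp
    show ?thesis unfolding \<phi>_def swap by simp
  qed
  ultimately show ?thesis by simp
qed

text \<open>
  For such \<open>f\<close> the terms of the right-hand side with large \<open>k\<close> vanish. So \<open>sampled_fourier_autocorrelation\<close>
  can be applied for each \<open>n\<close> with the same finite set of indices, and summing over \<open>n\<close> commutes with the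
  finite sum over \<open>k\<close>. As the energies are nonnegative, the iterated sum is the double sum.
\<close>

lemma identity_bounded_support:
  fixes f :: "real \<Rightarrow> complex"
  assumes f[measurable]: "f \<in> borel_measurable lebesgue" and C: "\<And>x. norm (f x) \<le> C" and R: "\<And>x. R < \<bar>x\<bar> \<Longrightarrow> f x = 0"
  shows "\<exists>S. ((\<lambda>i. (norm (coeff f i))\<^sup>2) has_sum S) UNIV \<and>
      of_real S = 1 / of_real b * (\<Sum>\<^sub>\<infinity>k. WH_rhs_term g a b f k)"
proof -
  define K where "K = {- \<lceil>2 * R * b\<rceil> .. \<lceil>2 * R * b\<rceil>}"
  have K: "finite K" by (simp add: K_def)
  have K': "k \<in> K" if "\<bar>of_int k / b\<bar> \<le> 2 * R" for k
  proof -
    have "\<bar>of_int k\<bar> \<le> 2 * R * b" using that b by (simp add: abs_divide field_simps)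
    then show ?thesis unfolding K_def atLeastAtMost_iff by linarith
  qed
  have out: "WH_rhs_term g a b f k = 0" if "k \<notin> K" for k
  proof -
    have z: "cnj (f t) * f (t - of_int k / b) = 0" for t
    proof (rule ccontr)
      assume "cnj (f t) * f (t - of_int k / b) \<noteq> 0"
      then have "\<bar>t\<bar> \<le> R" "\<bar>t - of_int k / b\<bar> \<le> R" using R[of t] R[of "t - of_int k / b"] by (force simp: not_le[symmetric])+
      then have "\<bar>of_int k / b\<bar> \<le> 2 * R" by linarith
      with K' that show False by blast
    qed
    show ?thesis unfolding WH_rhs_term_def z by simp
  qed
  have rhs: "(\<Sum>\<^sub>\<infinity>k. WH_rhs_term g a b f k) = (\<Sum>k\<in>K. WH_rhs_term g a b f k)"
  proof -
    have "(\<Sum>\<^sub>\<infinity>k. WH_rhs_term g a b f k) = infsum (WH_rhs_term g a b f) K"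
      by (rule infsum_cong_neutral) (use out in auto)
    then show ?thesis using K by simp
  qed
  define T :: complex where "T = 1 / of_real b * (\<Sum>k\<in>K. WH_rhs_term g a b f k)"
  define V where "V n = 1 / of_real b * (\<Sum>k\<in>K. LINT t|lebesgue. cnj (f t * cnj (g (t - of_int n * a)))
       * (f (t - of_int k / b) * cnj (g (t - of_int k / b - of_int n * a))))" for n :: int
  have inner: "((\<lambda>m. of_real ((norm (coeff f (m, n)))\<^sup>2) :: complex) has_sum V n) UNIV" for n
    unfolding V_def coeff_eq
  proof (rule sampled_fourier_autocorrelation[OF b _ _ _ K])
    show "(\<lambda>x. f x * cnj (g (x - of_int n * a))) \<in> borel_measurable lebesgue" by measurable
    show "AE x in lebesgue. norm (f x * cnj (g (x - of_int n * a))) \<le> C * sqrt B"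
      using AE_lebesgue_shift[OF g_bounded, of "of_int n * a"]
      by eventually_elim (use C in \<open>auto simp: norm_mult intro!: mult_mono order_trans[OF norm_ge_zero C]\<close>)
  qed (use R K' in auto)
  have outer: "(V has_sum T) UNIV"
    unfolding V_def T_def by (intro has_sum_cmult_right has_sum_finite_sum K rhs_term_has_sum[OF f C R])
  have inner': "((\<lambda>m. (norm (coeff f (m, n)))\<^sup>2) has_sum Re (V n)) UNIV" for n
    using has_sum_Re[OF inner[of n]] by simp
  have outer': "((\<lambda>n. Re (V n)) has_sum Re T) UNIV" using has_sum_Re[OF outer] .
  \<comment> \<open>The sums \<open>V n\<close> and \<open>T\<close> are real because they are sums of squared norms.\<close>
  have VR: "V n = of_real (Re (V n))" for n
    using has_sum_unique[OF inner has_sum_of_real[OF inner', of n]] by simp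
  have TR: "T = of_real (Re T)"
  proof -
    have "((\<lambda>n. of_real (Re (V n)) :: complex) has_sum of_real (Re T)) UNIV"
      by (rule has_sum_of_real[OF outer'])
    then have "(V has_sum of_real (Re T)) UNIV" by (simp flip: VR)
    then show ?thesis by (rule has_sum_unique[OF outer])
  qed
  have "((\<lambda>(n, m). (norm (coeff f (m, n)))\<^sup>2) has_sum Re T) (UNIV \<times> UNIV)"
  proof (rule has_sum_SigmaI)
    show "((\<lambda>m. case (n, m) of (n, m) \<Rightarrow> (norm (coeff f (m, n)))\<^sup>2) has_sum Re (V n)) UNIV" for n
      using inner' by simp
    show "(\<lambda>(n, m). (norm (coeff f (m, n)))\<^sup>2) summable_on UNIV \<times> UNIV"
      by (rule summable_on_SigmaI[where g="\<lambda>n. Re (V n)"])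
        (use inner' outer' in \<open>auto simp: summable_on_def\<close>)
  qed (rule outer')
  then have "((\<lambda>i. (norm (coeff f i))\<^sup>2) has_sum Re T) (UNIV \<times> UNIV)"
    using has_sum_swap[of "\<lambda>(n, m). (norm (coeff f (m, n)))\<^sup>2" UNIV UNIV] by (simp add: case_prod_unfold)
  moreover have "of_real (Re T) = 1 / of_real b * (\<Sum>\<^sub>\<infinity>k. WH_rhs_term g a b f k)"
    unfolding rhs T_def[symmetric] by (rule TR[symmetric])
  ultimately show ?thesis by (intro exI[of _ "Re T"]) simp
qed

section \<open>Absolute convergence of the right-hand side\<close>

text \<open>
  By the arithmetic-geometric mean inequality the integrand is at most the mean of \<open>\<bar>f(t)\<bar>\<^sup>2 \<bar>G\<^sub>k(t)\<bar>\<close> and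
  \<open>\<bar>f(t - k/b)\<bar>\<^sup>2 \<bar>G\<^sub>k(t)\<bar>\<close>. Summed over \<open>k\<close>, the first contributes at most \<open>B\<close> times the square norm of
  \<open>f\<close>, and so does the second, which \<open>G_shift\<close> turns into the first with \<open>- k\<close> in place of \<open>k\<close>.
\<close>

lemma rhs_nn_bound:
  assumes f: "f \<in> L2"
  shows "(\<integral>\<^sup>+k. \<integral>\<^sup>+t. ennreal (norm (cnj (f t) * f (t - of_int k / b) * G g a b k t)) \<partial>lebesgue \<partial>count_space UNIV)
     \<le> ennreal (B * (LINT t|lebesgue. (norm (f t))\<^sup>2))"
proof -
  note [measurable] = L2D(1)[OF f]
  let ?F = "\<lambda>t. ennreal ((norm (f t))\<^sup>2)" and ?G = "\<lambda>k t. ennreal (norm (G g a b k t))"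
  define P where "P k = (\<integral>\<^sup>+t. ?F t * ?G k t \<partial>lebesgue)" for k
  define Q where "Q k = (\<integral>\<^sup>+t. ?F (t - of_int k / b) * ?G k t \<partial>lebesgue)" for k
  have QP: "Q k = P (- k)" for k
  proof -
    have "(\<lambda>t. ?F (t - of_int k / b) * ?G k t) \<in> borel_measurable lebesgue" by measurable
    from nn_integral_lebesgue_shift[OF this, of "- of_int k / b"]
    show ?thesis by (simp add: Q_def P_def G_shift)
  qed
  have "(\<integral>\<^sup>+k. P k \<partial>count_space UNIV) = (\<integral>\<^sup>+t. (\<integral>\<^sup>+k. ?F t * ?G k t \<partial>count_space UNIV) \<partial>lebesgue)"
    unfolding P_def by (rule nn_integral_count_space_nn_integral[symmetric]) auto
  also have "\<dots> = (\<integral>\<^sup>+t. ?F t * (\<integral>\<^sup>+k. ?G k t \<partial>count_space UNIV) \<partial>lebesgue)"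
    by (simp add: nn_integral_cmult)
  also have "\<dots> \<le> (\<integral>\<^sup>+t. ?F t * ennreal B \<partial>lebesgue)"
    by (rule nn_integral_mono_AE) (use nn_CC in \<open>auto elim!: eventually_mono intro: mult_left_mono\<close>)
  also have "\<dots> = ennreal (B * (LINT t|lebesgue. (norm (f t))\<^sup>2))"
    using B by (subst nn_integral_multc) (auto simp: nn_integral_L2[OF f] ennreal_mult mult.commute)
  finally have Pb: "(\<integral>\<^sup>+k. P k \<partial>count_space UNIV) \<le> ennreal (B * (LINT t|lebesgue. (norm (f t))\<^sup>2))" .
  have "bij (uminus :: int \<Rightarrow> int)" by (rule bij_uminus)
  from nn_integral_bij_count_space[OF this, of P]
  have Qb: "(\<integral>\<^sup>+k. Q k \<partial>count_space UNIV) = (\<integral>\<^sup>+k. P k \<partial>count_space UNIV)" by (simp add: QP)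
  have "(\<integral>\<^sup>+t. ennreal (norm (cnj (f t) * f (t - of_int k / b) * G g a b k t)) \<partial>lebesgue)
      \<le> ennreal (1/2) * P k + ennreal (1/2) * Q k" for k
  proof -
    have "(\<integral>\<^sup>+t. ennreal (norm (cnj (f t) * f (t - of_int k / b) * G g a b k t)) \<partial>lebesgue)
       \<le> (\<integral>\<^sup>+t. ennreal (1/2) * (?F t * ?G k t) + ennreal (1/2) * (?F (t - of_int k / b) * ?G k t) \<partial>lebesgue)"
    proof (rule nn_integral_mono)
      fix t
      have "norm (cnj (f t) * f (t - of_int k / b) * G g a b k t)
         \<le> ((norm (f t))\<^sup>2 + (norm (f (t - of_int k / b)))\<^sup>2) / 2 * norm (G g a b k t)" (is "?x \<le> _")
        unfolding norm_mult[of _ "G g a b k t"]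
        using norm_mult_le_half_squares[of "cnj (f t)" "f (t - of_int k / b)"] by (intro mult_right_mono) auto
      also have "\<dots> = ((norm (f t))\<^sup>2 * norm (G g a b k t) + (norm (f (t - of_int k / b)))\<^sup>2 * norm (G g a b k t)) / 2"
        by (simp add: field_simps)
      finally show "ennreal ?x \<le> ennreal (1/2) * (?F t * ?G k t) + ennreal (1/2) * (?F (t - of_int k / b) * ?G k t)"
        unfolding ennreal_mult[symmetric, OF zero_le_power2 norm_ge_zero]
        by (rule ennreal_le_half_sum) auto
    qed
    also have "\<dots> = ennreal (1/2) * P k + ennreal (1/2) * Q k"
      unfolding P_def Q_def by (subst nn_integral_add) (auto simp: nn_integral_cmult)
    finally show ?thesis .
  qed
  then have "(\<integral>\<^sup>+k. \<integral>\<^sup>+t. ennreal (norm (cnj (f t) * f (t - of_int k / b) * G g a b k t)) \<partial>lebesgue \<partial>count_space UNIV)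
      \<le> (\<integral>\<^sup>+k. ennreal (1/2) * P k + ennreal (1/2) * Q k \<partial>count_space UNIV)"
    by (intro nn_integral_mono)
  also have "\<dots> = ennreal (1/2) * (\<integral>\<^sup>+k. P k \<partial>count_space UNIV) + ennreal (1/2) * (\<integral>\<^sup>+k. P k \<partial>count_space UNIV)"
    by (simp add: nn_integral_add nn_integral_cmult Qb)
  also have "\<dots> = (\<integral>\<^sup>+k. P k \<partial>count_space UNIV)"
    by (rule ennreal_half_plus_half)
  finally show ?thesis using Pb by (rule order_trans)
qed

end

section \<open>Truncations and convergence of square sums\<close>

abbreviation L2_normsq :: "(real \<Rightarrow> complex) \<Rightarrow> real" where
  "L2_normsq f \<equiv> (LINT t|lebesgue. (norm (f t))\<^sup>2)"

lemma L2_dominated: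
  assumes f: "f \<in> L2" and u: "u \<in> borel_measurable lebesgue" "\<And>x. norm (u x) \<le> norm (f x)"
  shows "u \<in> L2" "L2_normsq u \<le> L2_normsq f"
proof -
  have "integrable lebesgue (\<lambda>x. (norm (u x))\<^sup>2)"
    by (rule Bochner_Integration.integrable_bound[OF L2D(2)[OF f]]) (use u in \<open>auto intro!: AE_I2 power_mono\<close>)
  with u show "u \<in> L2" by (simp add: L2_def)
  then show "L2_normsq u \<le> L2_normsq f"
    using f u by (intro integral_mono L2D) (auto intro: power_mono)
qed

text \<open>
  Truncation in both domain and range approximates a function pointwise from below in modulus by
  bounded functions of bounded support.
\<close>

definition trunc :: "nat \<Rightarrow> (real \<Rightarrow> complex) \<Rightarrow> real \<Rightarrow> complex" where
  "trunc N f x = (if \<bar>x\<bar> \<le> real N \<and> norm (f x) \<le> real N then f x else 0)"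

lemma trunc_measurable [measurable]:
  assumes [measurable]: "f \<in> borel_measurable lebesgue"
  shows "trunc N f \<in> borel_measurable lebesgue"
  unfolding trunc_def[abs_def] by measurable

lemma norm_trunc_le: "norm (trunc N f x) \<le> norm (f x)" "norm (f x - trunc N f x) \<le> norm (f x)"
  "norm (trunc N f x) \<le> real N" "real N < \<bar>x\<bar> \<Longrightarrow> trunc N f x = 0"
  by (auto simp: trunc_def)

lemma eventually_trunc_eq: "\<forall>\<^sub>F N in sequentially. trunc N f x = f x"
proof -
  obtain N0 where "max \<bar>x\<bar> (norm (f x)) \<le> real N0" using real_arch_simple by blast
  then show ?thesis
    by (intro eventually_sequentiallyI[of N0]) (auto simp: trunc_def)
qed

lemma trunc_tendsto: "(\<lambda>N. trunc N f x) \<longlonglongrightarrow> f x"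
  by (rule tendsto_eventually[OF eventually_trunc_eq])

lemma trunc_diff_L2:
  assumes f: "f \<in> L2"
  shows "(\<lambda>x. f x - trunc N f x) \<in> L2"
  by (rule L2_dominated(1)[OF f]) (use L2D(1)[OF f] norm_trunc_le in auto)

lemma trunc_L2:
  assumes f: "f \<in> L2"
  shows "trunc N f \<in> L2" "L2_normsq (trunc N f) \<le> L2_normsq f"
  using L2_dominated[OF f trunc_measurable[OF L2D(1)[OF f]] norm_trunc_le(1)] by auto

lemma L2_normsq_trunc_diff:
  assumes f: "f \<in> L2"
  shows "(\<lambda>N. L2_normsq (\<lambda>x. f x - trunc N f x)) \<longlonglongrightarrow> 0"
proof -
  note [measurable] = L2D(1)[OF f]
  have "(\<lambda>N. L2_normsq (\<lambda>x. f x - trunc N f x)) \<longlonglongrightarrow> (LINT x|(lebesgue :: real measure). 0)"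
  proof (rule integral_dominated_convergence)
    show "integrable lebesgue (\<lambda>x. (norm (f x))\<^sup>2)" by (rule L2D(2)[OF f])
    show "AE x in lebesgue. (\<lambda>N. (norm (f x - trunc N f x))\<^sup>2) \<longlonglongrightarrow> 0"
    proof (rule AE_I2)
      fix x
      have "(\<lambda>N. (norm (f x - trunc N f x))\<^sup>2) \<longlonglongrightarrow> (norm (f x - f x))\<^sup>2"
        by (intro tendsto_intros trunc_tendsto)
      then show "(\<lambda>N. (norm (f x - trunc N f x))\<^sup>2) \<longlonglongrightarrow> 0" by simp
    qed
    show "AE x in lebesgue. norm ((norm (f x - trunc N f x))\<^sup>2) \<le> (norm (f x))\<^sup>2" for N
      by (rule AE_I2) (simp add: power_mono norm_trunc_le)
  qed measurable
  then show ?thesis by simp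
qed

text \<open>
  A difference of squares is at most the norm of the difference times the sum of the norms; weighting
  the two factors by \<open>e\<close> makes the right-hand side summable term by term.
\<close>

lemma square_le_perturbed_square:
  fixes x y :: "'a::real_normed_vector"
  assumes "e > 0"
  shows "(norm x)\<^sup>2 \<le> (norm y)\<^sup>2 + (e * ((norm x)\<^sup>2 + (norm y)\<^sup>2) + 1 / (2 * e) * (norm (x - y))\<^sup>2)"
proof -
  let ?d = "norm (x - y)" and ?s = "norm x + norm y"
  have "norm x - norm y \<le> ?d" by (rule norm_triangle_ineq2)
  then have "(norm x - norm y) * ?s \<le> ?d * ?s" by (intro mult_right_mono) auto
  moreover have "?d * ?s \<le> e / 2 * ?s\<^sup>2 + ?d\<^sup>2 / (2 * e)"
  proof -
    have "0 \<le> (e * ?s - ?d)\<^sup>2 / (2 * e)" using assms by simp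
    also have "\<dots> = e / 2 * ?s\<^sup>2 + ?d\<^sup>2 / (2 * e) - ?d * ?s"
      using assms by (simp add: power2_eq_square field_simps)
    finally show ?thesis by simp
  qed
  moreover have "e / 2 * ?s\<^sup>2 \<le> e * ((norm x)\<^sup>2 + (norm y)\<^sup>2)"
  proof -
    have "?s\<^sup>2 \<le> 2 * ((norm x)\<^sup>2 + (norm y)\<^sup>2)"
      using sum_squares_bound[of "norm x" "norm y"] by (simp add: power2_eq_square algebra_simps)
    then have "e / 2 * ?s\<^sup>2 \<le> e / 2 * (2 * ((norm x)\<^sup>2 + (norm y)\<^sup>2))"
      using assms by (intro mult_left_mono) auto
    then show ?thesis by (simp add: algebra_simps)
  qed
  ultimately show ?thesis by (simp add: power2_eq_square algebra_simps)
qed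

text \<open>
  For every \<open>e > 0\<close> the square norms of \<open>x\<close> and \<open>y N\<close> differ by at most \<open>2 * M * e\<close> plus \<open>D N / (2 * e)\<close>,
  where the second term tends to 0 for fixed \<open>e\<close>.
\<close>

lemma tendsto_sum_squares:
  fixes x :: "'i \<Rightarrow> complex" and y :: "nat \<Rightarrow> 'i \<Rightarrow> complex"
  assumes x: "((\<lambda>i. (norm (x i))\<^sup>2) has_sum X) A" and y: "\<And>N. ((\<lambda>i. (norm (y N i))\<^sup>2) has_sum Y N) A"
    and d: "\<And>N. ((\<lambda>i. (norm (x i - y N i))\<^sup>2) has_sum D N) A"
    and bound: "\<And>N. Y N \<le> M" "X \<le> M" and D: "D \<longlonglongrightarrow> 0"
  shows "Y \<longlonglongrightarrow> X"
proof (rule LIMSEQ_I)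
  fix r :: real assume r: "r > 0"
  have M: "0 \<le> M" using has_sum_nonneg[OF x] bound(2) by simp
  \<comment> \<open>The weight is chosen so that the terms not involving \<open>D\<close> contribute at most \<open>r / 2\<close>.\<close>
  define e where "e = r / (4 * (M + 1))"
  have e: "e > 0" using r M by (simp add: e_def)
  have close: "\<bar>Y N - X\<bar> \<le> e * (X + Y N) + 1 / (2 * e) * D N" for N
  proof -
    have "X \<le> Y N + (e * (X + Y N) + 1 / (2 * e) * D N)"
      by (rule has_sum_mono[OF x has_sum_add[OF y has_sum_add[OF has_sum_cmult_right[OF has_sum_add[OF x y]] has_sum_cmult_right[OF d]]]])
        (rule square_le_perturbed_square[OF e])
    moreover have d': "((\<lambda>i. (norm (y N i - x i))\<^sup>2) has_sum D N) A" using d by (simp add: norm_minus_commute)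
    have "Y N \<le> X + (e * (Y N + X) + 1 / (2 * e) * D N)"
      by (rule has_sum_mono[OF y has_sum_add[OF x has_sum_add[OF has_sum_cmult_right[OF has_sum_add[OF y x]] has_sum_cmult_right[OF d']]]])
        (rule square_le_perturbed_square[OF e])
    ultimately show ?thesis unfolding abs_le_iff by (simp add: algebra_simps)
  qed
  have small: "e * (X + Y N) \<le> r / 2" for N
  proof -
    have "e * (X + Y N) \<le> e * (2 * (M + 1))"
      using bound(1)[of N] bound(2) e by (intro mult_left_mono) auto
    also have "\<dots> = r / 2" using M by (simp add: e_def field_simps)
    finally show ?thesis .
  qed
  have "\<forall>\<^sub>F N in sequentially. D N < e * r" using D e r by (intro order_tendstoD) auto
  then obtain N0 where N0: "\<And>N. N \<ge> N0 \<Longrightarrow> D N < e * r" by (auto simp: eventually_sequentially)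
  have "norm (Y N - X) < r" if "N \<ge> N0" for N
  proof -
    have "1 / (2 * e) * D N < r / 2" using N0[OF that] e by (simp add: field_simps)
    with close[of N] small[of N] show ?thesis by simp
  qed
  then show "\<exists>no. \<forall>n\<ge>no. norm (Y n - X) < r" by blast
qed

section \<open>Passage to arbitrary square integrable functions\<close>

context CC_system
begin

lemma rhs_integrable:
  assumes f: "f \<in> L2"
  shows "integrable lebesgue (\<lambda>t. cnj (f t) * f (t - of_int k / b) * G g a b k t)"
proof (rule integrableI_bounded)
  note [measurable] = L2D(1)[OF f]
  show "(\<lambda>t. cnj (f t) * f (t - of_int k / b) * G g a b k t) \<in> borel_measurable lebesgue" by measurable
  have "(\<integral>\<^sup>+t. ennreal (norm (cnj (f t) * f (t - of_int k / b) * G g a b k t)) \<partial>lebesgue) \<le> ennreal (B * L2_normsq f)"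
    by (rule order_trans[OF nn_integral_ge_point rhs_nn_bound[OF f]]) simp
  then show "(\<integral>\<^sup>+t. ennreal (norm (cnj (f t) * f (t - of_int k / b) * G g a b k t)) \<partial>lebesgue) < \<infinity>"
    by (simp add: le_less_trans[OF _ ennreal_less_top])
qed

text \<open>
  One sequence that dominates the right-hand series of \<open>f\<close> and of all truncations of \<open>f\<close> at once.
\<close>

definition rhs_majorant :: "(real \<Rightarrow> complex) \<Rightarrow> int \<Rightarrow> real" where
  "rhs_majorant f k = (LINT t|lebesgue. norm (cnj (f t) * f (t - of_int k / b) * G g a b k t))"

lemma rhs_majorant_summable:
  assumes f: "f \<in> L2"
  shows "rhs_majorant f summable_on UNIV \<and> infsum (rhs_majorant f) UNIV \<le> B * L2_normsq f"
proof (rule infsum_le_of_nn_integral_le)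
  have "(\<integral>\<^sup>+k. ennreal (rhs_majorant f k) \<partial>count_space UNIV) =
    (\<integral>\<^sup>+k. \<integral>\<^sup>+t. ennreal (norm (cnj (f t) * f (t - of_int k / b) * G g a b k t)) \<partial>lebesgue \<partial>count_space UNIV)"
    unfolding rhs_majorant_def
    by (rule nn_integral_cong, rule nn_integral_eq_integral[symmetric]) (use rhs_integrable[OF f] in auto)
  then show "(\<integral>\<^sup>+k. ennreal (rhs_majorant f k) \<partial>count_space UNIV) \<le> ennreal (B * L2_normsq f)"
    using rhs_nn_bound[OF f] by simp
qed (auto simp: rhs_majorant_def B)

lemma norm_rhs_term_le: "norm (WH_rhs_term g a b f k) \<le> rhs_majorant f k"
  unfolding WH_rhs_term_def rhs_majorant_def by (rule integral_norm_bound)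

lemma rhs_term_abs_summable:
  assumes f: "f \<in> L2"
  shows "(\<lambda>k. norm (WH_rhs_term g a b f k)) summable_on UNIV"
  by (rule summable_on_comparison_test[OF conjunct1[OF rhs_majorant_summable[OF f]]]) (auto simp: norm_rhs_term_le)

lemma norm_rhs_le:
  assumes f: "f \<in> L2"
  shows "norm (\<Sum>\<^sub>\<infinity>k. WH_rhs_term g a b f k) \<le> B * L2_normsq f"
proof -
  have "norm (\<Sum>\<^sub>\<infinity>k. WH_rhs_term g a b f k) \<le> (\<Sum>\<^sub>\<infinity>k. norm (WH_rhs_term g a b f k))"
    by (rule norm_infsum_bound[OF rhs_term_abs_summable[OF f]])
  also have "\<dots> \<le> infsum (rhs_majorant f) UNIV"
    by (rule infsum_mono[OF rhs_term_abs_summable[OF f]]) (use rhs_majorant_summable[OF f] norm_rhs_term_le in auto)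
  finally show ?thesis using rhs_majorant_summable[OF f] by simp
qed

lemma coeff_integrable:
  assumes f: "f \<in> L2"
  shows "integrable lebesgue (\<lambda>x. f x * cnj (g (x - of_int n * a)) * wave c x)"
proof (rule Bochner_Integration.integrable_bound)
  note [measurable] = L2D(1)[OF f]
  show "integrable lebesgue (\<lambda>x. ((norm (f x))\<^sup>2 + (norm (g (x - of_int n * a)))\<^sup>2) / 2)"
    using L2D(2)[OF f] integrable_lebesgue_shift[of "\<lambda>x. (norm (g x))\<^sup>2"] L2D(2)[OF g]
    by (intro integrable_divide_zero Bochner_Integration.integrable_add) auto
  show "AE x in lebesgue. norm (f x * cnj (g (x - of_int n * a)) * wave c x)
      \<le> norm (((norm (f x))\<^sup>2 + (norm (g (x - of_int n * a)))\<^sup>2) / 2)"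
  proof (rule AE_I2)
    fix x
    show "norm (f x * cnj (g (x - of_int n * a)) * wave c x)
      \<le> norm (((norm (f x))\<^sup>2 + (norm (g (x - of_int n * a)))\<^sup>2) / 2)"
      using norm_mult_le_half_squares[of "f x" "cnj (g (x - of_int n * a))"] by (simp add: norm_mult)
  qed
qed (use L2D(1)[OF f] in measurable)

lemma coeff_diff:
  assumes "f \<in> L2" "h \<in> L2"
  shows "coeff (\<lambda>x. f x - h x) i = coeff f i - coeff h i"
proof -
  obtain m n where i: "i = (m, n)" by fastforce
  show ?thesis unfolding i coeff_eq left_diff_distrib
    by (rule Bochner_Integration.integral_diff) (use assms coeff_integrable in auto)
qed

lemma coeff_trunc_tendsto:
  assumes f: "f \<in> L2"
  shows "(\<lambda>N. coeff (trunc N f) i) \<longlonglongrightarrow> coeff f i"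
proof -
  note [measurable] = L2D(1)[OF f]
  obtain m n where i: "i = (m, n)" by fastforce
  show ?thesis unfolding i coeff_eq
  proof (rule integral_dominated_convergence[where w="\<lambda>x. norm (f x * cnj (g (x - of_int n * a)) * wave (- (of_int m * b)) x)"])
    show "AE x in lebesgue. (\<lambda>N. trunc N f x * cnj (g (x - of_int n * a)) * wave (- (of_int m * b)) x)
       \<longlonglongrightarrow> f x * cnj (g (x - of_int n * a)) * wave (- (of_int m * b)) x"
      by (intro AE_I2 tendsto_intros trunc_tendsto)
    show "AE x in lebesgue. norm (trunc N f x * cnj (g (x - of_int n * a)) * wave (- (of_int m * b)) x)
       \<le> norm (f x * cnj (g (x - of_int n * a)) * wave (- (of_int m * b)) x)" for N
      by (rule AE_I2) (simp add: norm_mult mult_right_mono norm_trunc_le)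
  qed (auto intro!: coeff_integrable[OF f])
qed

lemma identity_trunc:
  assumes f: "f \<in> L2"
  shows "((\<lambda>i. (norm (coeff (trunc N f) i))\<^sup>2) has_sum (\<Sum>\<^sub>\<infinity>i. (norm (coeff (trunc N f) i))\<^sup>2)) UNIV"
    and "of_real (\<Sum>\<^sub>\<infinity>i. (norm (coeff (trunc N f) i))\<^sup>2) = 1 / of_real b * (\<Sum>\<^sub>\<infinity>k. WH_rhs_term g a b (trunc N f) k)"
proof -
  have "\<exists>S. ((\<lambda>i. (norm (coeff (trunc N f) i))\<^sup>2) has_sum S) UNIV \<and>
      of_real S = 1 / of_real b * (\<Sum>\<^sub>\<infinity>k. WH_rhs_term g a b (trunc N f) k)"
    by (rule identity_bounded_support[where R="real N" and C="real N"]) (use L2D(1)[OF f] norm_trunc_le in auto)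
  then obtain S where S: "((\<lambda>i. (norm (coeff (trunc N f) i))\<^sup>2) has_sum S) UNIV"
    "of_real S = 1 / of_real b * (\<Sum>\<^sub>\<infinity>k. WH_rhs_term g a b (trunc N f) k)" by blast
  have eq: "(\<Sum>\<^sub>\<infinity>i. (norm (coeff (trunc N f) i))\<^sup>2) = S" using S(1) by (rule infsumI)
  from S show "((\<lambda>i. (norm (coeff (trunc N f) i))\<^sup>2) has_sum (\<Sum>\<^sub>\<infinity>i. (norm (coeff (trunc N f) i))\<^sup>2)) UNIV"
    and "of_real (\<Sum>\<^sub>\<infinity>i. (norm (coeff (trunc N f) i))\<^sup>2) = 1 / of_real b * (\<Sum>\<^sub>\<infinity>k. WH_rhs_term g a b (trunc N f) k)"
    unfolding eq by auto
qed

text \<open>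
  The identity, which is already known for truncations, transfers the bound of the right-hand side to
  the left-hand side.
\<close>

lemma bessel_trunc:
  assumes f: "f \<in> L2"
  shows "(\<Sum>\<^sub>\<infinity>i. (norm (coeff (trunc N f) i))\<^sup>2) \<le> B / b * L2_normsq f"
proof -
  let ?S = "\<Sum>\<^sub>\<infinity>i. (norm (coeff (trunc N f) i))\<^sup>2"
  have "?S \<le> norm (of_real ?S :: complex)" by simp
  also have "\<dots> = 1 / b * norm (\<Sum>\<^sub>\<infinity>k. WH_rhs_term g a b (trunc N f) k)"
    unfolding identity_trunc(2)[OF f] using b by (simp add: norm_mult norm_divide)
  also have "\<dots> \<le> 1 / b * (B * L2_normsq f)"
    using norm_rhs_le[OF trunc_L2(1)[OF f], of N] mult_left_mono[OF trunc_L2(2)[OF f, of N] B] b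
    by (intro mult_left_mono) auto
  finally show ?thesis by simp
qed

text \<open>
  Each coefficient depends continuously on \<open>f\<close> along truncations, so every finite partial sum inherits
  the bound for truncations.
\<close>

lemma bessel:
  assumes f: "f \<in> L2"
  shows "(\<lambda>i. (norm (coeff f i))\<^sup>2) summable_on UNIV"
    and "(\<Sum>\<^sub>\<infinity>i. (norm (coeff f i))\<^sup>2) \<le> B / b * L2_normsq f"
proof -
  have fin: "(\<Sum>i\<in>I. (norm (coeff f i))\<^sup>2) \<le> B / b * L2_normsq f" if I: "finite I" for I
  proof (rule LIMSEQ_le_const2)
    show "(\<lambda>N. \<Sum>i\<in>I. (norm (coeff (trunc N f) i))\<^sup>2) \<longlonglongrightarrow> (\<Sum>i\<in>I. (norm (coeff f i))\<^sup>2)"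
      by (intro tendsto_intros coeff_trunc_tendsto[OF f])
    have "(\<Sum>i\<in>I. (norm (coeff (trunc N f) i))\<^sup>2) \<le> B / b * L2_normsq f" for N
      by (rule order_trans[OF finite_sum_le_infsum bessel_trunc[OF f, of N]])
        (use I identity_trunc(1)[OF f, of N] in \<open>auto simp: summable_on_def\<close>)
    then show "\<exists>N0. \<forall>N\<ge>N0. (\<Sum>i\<in>I. (norm (coeff (trunc N f) i))\<^sup>2) \<le> B / b * L2_normsq f" by blast
  qed
  show s: "(\<lambda>i. (norm (coeff f i))\<^sup>2) summable_on UNIV"
    by (rule nonneg_bdd_above_summable_on) (auto intro!: bdd_aboveI[of _ "B / b * L2_normsq f"] fin)
  show "(\<Sum>\<^sub>\<infinity>i. (norm (coeff f i))\<^sup>2) \<le> B / b * L2_normsq f"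
    by (rule infsum_le_finite_sums[OF s]) (use fin in auto)
qed

text \<open>
  Coefficients are linear in \<open>f\<close>, so Bessel's inequality for \<open>f - trunc N f\<close> says that the coefficients
  of the truncations converge in \<open>\<ell>\<^sup>2\<close>.
\<close>

lemma lhs_trunc_tendsto:
  assumes f: "f \<in> L2"
  shows "(\<lambda>N. \<Sum>\<^sub>\<infinity>i. (norm (coeff (trunc N f) i))\<^sup>2) \<longlonglongrightarrow> (\<Sum>\<^sub>\<infinity>i. (norm (coeff f i))\<^sup>2)"
proof (rule tendsto_sum_squares[where M="B / b * L2_normsq f" and A=UNIV])
  show "((\<lambda>i. (norm (coeff f i))\<^sup>2) has_sum (\<Sum>\<^sub>\<infinity>i. (norm (coeff f i))\<^sup>2)) UNIV"
    using bessel(1)[OF f] by (rule has_sum_infsum)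
  let ?u = "\<lambda>N x. f x - trunc N f x"
  have u: "?u N \<in> L2" for N by (rule trunc_diff_L2[OF f])
  show "((\<lambda>i. (norm (coeff f i - coeff (trunc N f) i))\<^sup>2) has_sum (\<Sum>\<^sub>\<infinity>i. (norm (coeff (?u N) i))\<^sup>2)) UNIV" for N
    using has_sum_infsum[OF bessel(1)[OF u]] unfolding coeff_diff[OF f trunc_L2(1)[OF f]] .
  show "(\<lambda>N. \<Sum>\<^sub>\<infinity>i. (norm (coeff (?u N) i))\<^sup>2) \<longlonglongrightarrow> 0"
  proof (rule tendsto_sandwich)
    show "\<forall>\<^sub>F N in sequentially. 0 \<le> (\<Sum>\<^sub>\<infinity>i. (norm (coeff (?u N) i))\<^sup>2)"
      by (intro always_eventually allI infsum_nonneg) auto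
    show "\<forall>\<^sub>F N in sequentially. (\<Sum>\<^sub>\<infinity>i. (norm (coeff (?u N) i))\<^sup>2) \<le> B / b * L2_normsq (?u N)"
      using bessel(2)[OF u] by (intro always_eventually allI)
    show "(\<lambda>N. B / b * L2_normsq (?u N)) \<longlonglongrightarrow> 0"
      using tendsto_mult_left[OF L2_normsq_trunc_diff[OF f], of "B / b"] by simp
  qed simp
qed (use identity_trunc(1)[OF f] bessel_trunc[OF f] bessel(2)[OF f] in auto)

text \<open>
  Dominated convergence twice: in the integral for each \<open>k\<close>, and in the sum over \<open>k\<close>.
\<close>

lemma rhs_trunc_tendsto:
  assumes f: "f \<in> L2"
  shows "(\<lambda>N. \<Sum>\<^sub>\<infinity>k. WH_rhs_term g a b (trunc N f) k) \<longlonglongrightarrow> (\<Sum>\<^sub>\<infinity>k. WH_rhs_term g a b f k)"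
proof (rule tannery_infsum[where M="rhs_majorant f"])
  note [measurable] = L2D(1)[OF f]
  let ?h = "\<lambda>f k t. cnj (f t) * f (t - of_int k / b) * G g a b k t"
  have dom: "norm (?h (trunc N f) k t) \<le> norm (?h f k t)" for N k t
    by (simp add: norm_mult mult_mono norm_trunc_le)
  show "norm (WH_rhs_term g a b (trunc N f) k) \<le> rhs_majorant f k" for N k
  proof (rule order_trans[OF norm_rhs_term_le])
    show "rhs_majorant (trunc N f) k \<le> rhs_majorant f k"
      unfolding rhs_majorant_def
      by (intro integral_mono integrable_norm rhs_integrable trunc_L2 f dom)
  qed
  show "(\<lambda>N. WH_rhs_term g a b (trunc N f) k) \<longlonglongrightarrow> WH_rhs_term g a b f k" for k
    unfolding WH_rhs_term_def
  proof (rule integral_dominated_convergence[where w="\<lambda>t. norm (?h f k t)"])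
    show "AE t in lebesgue. (\<lambda>N. ?h (trunc N f) k t) \<longlonglongrightarrow> ?h f k t"
      by (intro AE_I2 tendsto_intros trunc_tendsto)
    show "AE t in lebesgue. norm (?h (trunc N f) k t) \<le> norm (?h f k t)" for N
      by (rule AE_I2[OF dom])
  qed (auto intro!: rhs_integrable[OF f])
  show "rhs_majorant f summable_on UNIV" using rhs_majorant_summable[OF f] by simp
qed

lemma WH_identity:
  assumes f: "f \<in> L2"
  shows "WH_frame_identity g a b f" and "WH_rhs_term g a b f summable_on UNIV"
proof -
  show "WH_rhs_term g a b f summable_on UNIV"
    using rhs_term_abs_summable[OF f] by (rule abs_summable_summable)
  have "(\<lambda>N. of_real (\<Sum>\<^sub>\<infinity>i. (norm (coeff (trunc N f) i))\<^sup>2) :: complex) \<longlonglongrightarrow> of_real (\<Sum>\<^sub>\<infinity>i. (norm (coeff f i))\<^sup>2)"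
    by (intro tendsto_of_real lhs_trunc_tendsto f)
  moreover have "(\<lambda>N. of_real (\<Sum>\<^sub>\<infinity>i. (norm (coeff (trunc N f) i))\<^sup>2)) \<longlonglongrightarrow> 1 / of_real b * (\<Sum>\<^sub>\<infinity>k. WH_rhs_term g a b f k)"
    unfolding identity_trunc(2)[OF f] by (intro tendsto_mult_left rhs_trunc_tendsto f)
  ultimately have "of_real (\<Sum>\<^sub>\<infinity>i. (norm (coeff f i))\<^sup>2) = 1 / of_real b * (\<Sum>\<^sub>\<infinity>k. WH_rhs_term g a b f k)"
    by (rule LIMSEQ_unique)
  then show "WH_frame_identity g a b f"
    using bessel(1)[OF f] rhs_integrable[OF f]
    by (simp add: WH_frame_identity_def coeff_def case_prod_unfold)
qed

end

section \<open>The Wiener amalgam space\<close>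

lemma nn_integral_count_space_le_infsum:
  fixes u :: "int \<Rightarrow> ennreal"
  shows "(\<integral>\<^sup>+n. u n \<partial>count_space UNIV) \<le> infsum u UNIV"
proof -
  have "(\<integral>\<^sup>+n. u n \<partial>count_space UNIV) = (\<Sum>i. u (int_decode i))"
    by (simp add: nn_integral_bij_count_space[OF bij_int_decode, symmetric] nn_integral_count_space_nat)
  also have "\<dots> = (SUP n. \<Sum>i<n. u (int_decode i))" by (rule suminf_eq_SUP)
  also have "\<dots> \<le> infsum u UNIV"
  proof (rule SUP_least)
    fix n
    have "(\<Sum>i<n. u (int_decode i)) = sum u (int_decode ` {..<n})"
      by (subst sum.reindex) (auto intro: inj_on_subset[OF inj_int_decode])
    also have "\<dots> \<le> infsum u UNIV"
      unfolding nonneg_infsum_complete[of UNIV u, OF zero_le] by (rule SUP_upper) auto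
    finally show "(\<Sum>i<n. u (int_decode i)) \<le> infsum u UNIV" .
  qed
  finally show ?thesis .
qed

lemma ennreal_norm_infsum_le:
  fixes h :: "int \<Rightarrow> complex"
  shows "ennreal (norm (infsum h UNIV)) \<le> (\<integral>\<^sup>+n. ennreal (norm (h n)) \<partial>count_space UNIV)"
proof (cases "h summable_on UNIV")
  case True
  then have s: "(\<lambda>n. norm (h n)) summable_on UNIV" by (simp add: summable_on_iff_abs_summable_on_complex)
  have "norm (infsum h UNIV) \<le> (\<Sum>\<^sub>\<infinity>n. norm (h n))" by (rule norm_infsum_bound[OF s])
  then show ?thesis using s by (subst nn_integral_count_space_infsum) (auto intro: ennreal_leI)
qed (simp add: infsum_not_exists)

lemma count_progression_in_interval:
  fixes s p x l :: real
  assumes p: "p > 0" and l: "l > 0"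
  shows "(\<integral>\<^sup>+(k::int). indicator {x..<x + l} (s - of_int k * p) \<partial>count_space UNIV) \<le> ennreal (l / p + 1)"
proof -
  let ?y = "(s - x) / p"
  let ?I = "{\<lfloor>?y - l / p\<rfloor> + 1..\<lfloor>?y\<rfloor>}"
  have "indicator {x..<x + l} (s - of_int k * p) \<le> (indicator ?I k :: ennreal)" for k :: int
  proof (cases "s - of_int k * p \<in> {x..<x + l}")
    case True
    then have "of_int k \<le> ?y" "(s - x - l) / p < of_int k"
      using p by (auto simp: pos_le_divide_eq pos_divide_less_eq mult.commute)
    then have "of_int k \<le> ?y" "?y - l / p < of_int k" by (auto simp: diff_divide_distrib)
    then have "k \<in> ?I" by (simp add: le_floor_iff floor_less_iff add1_zle_eq)
    then show ?thesis by (simp add: indicator_def)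
  qed simp
  then have "(\<integral>\<^sup>+(k::int). indicator {x..<x + l} (s - of_int k * p) \<partial>count_space UNIV)
      \<le> (\<integral>\<^sup>+k. indicator ?I k \<partial>count_space UNIV)" by (intro nn_integral_mono)
  also have "\<dots> = of_nat (card ?I)" by simp
  also have "\<dots> = ennreal (real (card ?I))" by (simp add: ennreal_of_nat_eq_real_of_nat)
  also have "\<dots> \<le> ennreal (l / p + 1)"
  proof (rule ennreal_leI)
    have "real (card ?I) = max 0 (of_int (\<lfloor>?y\<rfloor> - \<lfloor>?y - l / p\<rfloor>))" by simp
    also have "\<dots> \<le> l / p + 1"
    proof -
      have "0 \<le> l / p" using p l by simp
      then show ?thesis by linarith
    qed
    finally show "real (card ?I) \<le> l / p + 1" .
  qed
  finally show ?thesis .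
qed

text \<open>
  The value of \<open>\<bar>g\<bar>\<close> at a point is at most the bound \<open>M j\<close> of the interval that contains the point, and
  each interval contains a bounded number of points of the progression. In the application \<open>M j\<close> is the
  essential supremum of \<open>\<bar>g\<bar>\<close> on the \<open>j\<close>-th interval.
\<close>

lemma amalgam_periodization_le:
  fixes M :: "int \<Rightarrow> ennreal" and g :: "real \<Rightarrow> complex"
  assumes \<alpha>: "\<alpha> > 0" and p: "p > 0"
    and M: "\<And>k j. ennreal (norm (g (s - of_int k * p) * indicator {\<alpha> * of_int j..<\<alpha> * (of_int j + 1)} (s - of_int k * p))) \<le> M j"
  shows "(\<integral>\<^sup>+(k::int). ennreal (norm (g (s - of_int k * p))) \<partial>count_space UNIV)
    \<le> ennreal (\<alpha> / p + 1) * (\<integral>\<^sup>+j. M j \<partial>count_space UNIV)"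
proof -
  let ?I = "\<lambda>j::int. {\<alpha> * of_int j..<\<alpha> * of_int j + \<alpha>}"
  have "ennreal (norm (g (s - of_int k * p))) \<le> (\<integral>\<^sup>+j. M j * indicator (?I j) (s - of_int k * p) \<partial>count_space UNIV)" for k :: int
  proof -
    let ?x = "s - of_int k * p" and ?j = "\<lfloor>(s - of_int k * p) / \<alpha>\<rfloor>"
    have "?x \<in> ?I ?j" using cell_unique[OF \<alpha>, of ?x "- ?j"] \<alpha> by (auto simp: algebra_simps)
    then have "ennreal (norm (g ?x)) \<le> M ?j * indicator (?I ?j) ?x"
      using M[of k ?j] by (simp add: indicator_def distrib_left)
    also have "\<dots> \<le> (\<integral>\<^sup>+j. M j * indicator (?I j) ?x \<partial>count_space UNIV)"
      by (rule nn_integral_ge_point) simp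
    finally show ?thesis .
  qed
  then have "(\<integral>\<^sup>+(k::int). ennreal (norm (g (s - of_int k * p))) \<partial>count_space UNIV)
     \<le> (\<integral>\<^sup>+(k::int). (\<integral>\<^sup>+j. M j * indicator (?I j) (s - of_int k * p) \<partial>count_space UNIV) \<partial>count_space UNIV)"
    by (intro nn_integral_mono)
  also have "\<dots> = (\<integral>\<^sup>+j. (\<integral>\<^sup>+(k::int). M j * indicator (?I j) (s - of_int k * p) \<partial>count_space UNIV) \<partial>count_space UNIV)"
    by (rule nn_integral_count_space_nn_integral) auto
  also have "\<dots> \<le> (\<integral>\<^sup>+j. ennreal (\<alpha> / p + 1) * M j \<partial>count_space UNIV)"
  proof (rule nn_integral_mono)
    fix j :: int
    have "(\<integral>\<^sup>+(k::int). M j * indicator (?I j) (s - of_int k * p) \<partial>count_space UNIV)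
      = M j * (\<integral>\<^sup>+(k::int). indicator (?I j) (s - of_int k * p) \<partial>count_space UNIV)"
      by (simp add: nn_integral_cmult)
    also have "\<dots> \<le> M j * ennreal (\<alpha> / p + 1)"
      by (intro mult_left_mono count_progression_in_interval p \<alpha>) simp
    finally show "(\<integral>\<^sup>+(k::int). M j * indicator (?I j) (s - of_int k * p) \<partial>count_space UNIV) \<le> ennreal (\<alpha> / p + 1) * M j"
      by (simp add: mult.commute)
  qed
  also have "\<dots> = ennreal (\<alpha> / p + 1) * (\<integral>\<^sup>+j. M j \<partial>count_space UNIV)"
    by (simp add: nn_integral_cmult)
  finally show ?thesis .
qed

text \<open>
  Expanding \<open>G\<^sub>k\<close> and summing over \<open>k\<close> first, the sum of the norms is at most the periodization of \<open>\<bar>g\<bar>\<close> with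
  step \<open>a\<close> times a uniform bound of its periodizations with step \<open>1/b\<close>; both are finite by
  \<open>amalgam_periodization_le\<close>, away from the null set where some translate of \<open>t\<close> violates the bound by an
  essential supremum.
\<close>

lemma wiener_amalgam_imp_CC:
  assumes a: "a > 0" and b: "b > 0" and g: "g \<in> wiener_amalgam"
  shows "CC_condition g a b"
proof -
  from g obtain \<alpha> where [measurable]: "g \<in> borel_measurable lebesgue" and \<alpha>: "\<alpha> > 0" 
    and fin: "(\<Sum>\<^sub>\<infinity>n::int. esssup lebesgue
        (\<lambda>x. ennreal (norm (g x * indicator {\<alpha> * of_int n ..< \<alpha> * (of_int n + 1)} x)))) < \<infinity>"
    unfolding wiener_amalgam_def by blast
  define M where "M n = esssup lebesgue
        (\<lambda>x. ennreal (norm (g x * indicator {\<alpha> * of_int n ..< \<alpha> * (of_int n + 1)} x)))" for n :: int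
  define W where "W = (\<integral>\<^sup>+n. M n \<partial>count_space UNIV)"
  have W: "W < \<infinity>"
    using fin nn_integral_count_space_le_infsum[of M] unfolding W_def M_def by (rule le_less_trans[rotated])
  define Good where "Good x \<longleftrightarrow> (\<forall>j::int. ennreal (norm (g x * indicator {\<alpha> * of_int j ..< \<alpha> * (of_int j + 1)} x)) \<le> M j)" for x
  have Good: "AE x in lebesgue. Good x"
    unfolding Good_def M_def by (intro AE_all_countable[THEN iffD2] allI esssup_AE)
  define C where "C = ennreal (\<alpha> / a + 1) * W * (ennreal (\<alpha> / (1/b) + 1) * W)"
  have "AE t in lebesgue. \<forall>(n::int) (k::int). Good (t - (of_int n * a + of_int k / b))"
    by (intro AE_all_countable[THEN iffD2] allI AE_lebesgue_shift[OF Good])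
  then have bound: "AE t in lebesgue. (\<integral>\<^sup>+k. ennreal (norm (G g a b k t)) \<partial>count_space UNIV) \<le> C"
  proof eventually_elim
    case (elim t)
    have "(\<integral>\<^sup>+k. ennreal (norm (G g a b k t)) \<partial>count_space UNIV)
      \<le> (\<integral>\<^sup>+(k::int). (\<integral>\<^sup>+(n::int). ennreal (norm (g (t - of_int n * a))) * ennreal (norm (g (t - of_int n * a - of_int k * (1/b))))
            \<partial>count_space UNIV) \<partial>count_space UNIV)"
    proof (rule nn_integral_mono)
      fix k :: int
      show "ennreal (norm (G g a b k t)) \<le> (\<integral>\<^sup>+(n::int). ennreal (norm (g (t - of_int n * a))) * ennreal (norm (g (t - of_int n * a - of_int k * (1/b))))
            \<partial>count_space UNIV)"
        unfolding G_def using ennreal_norm_infsum_le[of "\<lambda>n. g (t - of_int n * a) * cnj (g (t - of_int n * a - of_int k / b))"]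
        by (simp add: norm_mult ennreal_mult)
    qed
    also have "\<dots> = (\<integral>\<^sup>+(n::int). (\<integral>\<^sup>+(k::int). ennreal (norm (g (t - of_int n * a))) * ennreal (norm (g (t - of_int n * a - of_int k * (1/b))))
            \<partial>count_space UNIV) \<partial>count_space UNIV)"
      by (rule nn_integral_count_space_nn_integral) auto
    also have "\<dots> = (\<integral>\<^sup>+(n::int). ennreal (norm (g (t - of_int n * a))) * (\<integral>\<^sup>+(k::int). ennreal (norm (g (t - of_int n * a - of_int k * (1/b))))
            \<partial>count_space UNIV) \<partial>count_space UNIV)"
      by (simp add: nn_integral_cmult)
    also have "\<dots> \<le> (\<integral>\<^sup>+(n::int). ennreal (norm (g (t - of_int n * a))) * (ennreal (\<alpha> / (1/b) + 1) * W) \<partial>count_space UNIV)"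
    proof (intro nn_integral_mono mult_left_mono)
      fix n :: int
      show "(\<integral>\<^sup>+(k::int). ennreal (norm (g (t - of_int n * a - of_int k * (1/b)))) \<partial>count_space UNIV) \<le> ennreal (\<alpha> / (1/b) + 1) * W"
        unfolding W_def
      proof (rule amalgam_periodization_le[OF \<alpha>])
        fix k j :: int
        show "ennreal (norm (g (t - of_int n * a - of_int k * (1/b)) * indicator {\<alpha> * of_int j..<\<alpha> * (of_int j + 1)} (t - of_int n * a - of_int k * (1/b)))) \<le> M j"
          using elim[rule_format, of n k] unfolding Good_def by (simp add: diff_diff_eq)
      qed (use b in simp)
    qed simp
    also have "\<dots> = (\<integral>\<^sup>+(n::int). ennreal (norm (g (t - of_int n * a))) \<partial>count_space UNIV) * (ennreal (\<alpha> / (1/b) + 1) * W)"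
      by (simp add: nn_integral_multc)
    also have "\<dots> \<le> ennreal (\<alpha> / a + 1) * W * (ennreal (\<alpha> / (1/b) + 1) * W)"
    proof (rule mult_right_mono)
      show "(\<integral>\<^sup>+(n::int). ennreal (norm (g (t - of_int n * a))) \<partial>count_space UNIV) \<le> ennreal (\<alpha> / a + 1) * W"
        unfolding W_def
      proof (rule amalgam_periodization_le[OF \<alpha> a])
        fix n j :: int
        show "ennreal (norm (g (t - of_int n * a) * indicator {\<alpha> * of_int j..<\<alpha> * (of_int j + 1)} (t - of_int n * a))) \<le> M j"
          using elim[rule_format, of n 0] unfolding Good_def by simp
      qed
    qed simp
    finally show ?case by (simp add: C_def)
  qed
  have C: "C < \<infinity>" unfolding C_def using W by (simp add: ennreal_mult_less_top)
  define B where "B = enn2real C"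
  have CB: "C = ennreal B" "0 \<le> B" using C by (auto simp: B_def)
  have "AE t in lebesgue. (\<lambda>k. norm (G g a b k t)) summable_on UNIV \<and> (\<Sum>\<^sub>\<infinity>k. norm (G g a b k t)) \<le> B"
    using bound by eventually_elim (rule infsum_le_of_nn_integral_le, auto simp: CB)
  then show ?thesis unfolding CC_condition_def by blast
qed

theorem corollary5p11:
  fixes a b :: real and g :: "real \<Rightarrow> complex"
  assumes "a > 0" and "b > 0" and "g \<in> L2"
  shows "(CC_condition g a b \<longrightarrow>
            (\<forall>f\<in>L2. WH_frame_identity g a b f \<and> WH_rhs_term g a b f summable_on UNIV)) \<and>
         (g \<in> wiener_amalgam \<longrightarrow>
            (\<forall>f\<in>L2. WH_frame_identity g a b f \<and> WH_rhs_term g a b f summable_on UNIV))"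
proof -
  have main: "\<forall>f\<in>L2. WH_frame_identity g a b f \<and> WH_rhs_term g a b f summable_on UNIV" if "CC_condition g a b"
  proof -
    from that obtain B where B: "AE t in lebesgue.
        (\<lambda>k. norm (G g a b k t)) summable_on UNIV \<and> (\<Sum>\<^sub>\<infinity>k. norm (G g a b k t)) \<le> B"
      unfolding CC_condition_def by blast
    interpret CC_system a b "max 0 B" g
    proof unfold_locales
      show "AE t in lebesgue. (\<lambda>k. norm (G g a b k t)) summable_on UNIV \<and>
          (\<Sum>\<^sub>\<infinity>k. norm (G g a b k t)) \<le> max 0 B"
        using B by eventually_elim auto
    qed (use assms in auto)
    show ?thesis using WH_identity by blast
  qed
  then show ?thesis using wiener_amalgam_imp_CC[OF assms(1,2)] by blast
qed

end
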